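(* Let $K$ be a field, $S=K[x_1,\ldots,x_n]$, and let $I\subset S$ be a monomial ideal such that $S/I$ is Cohen–Macaulay. Let $I^p\subset T$ be the polarization of $I$. If $I$ is a Stanley ideal (i.e. $S/I$ has a Stanley decomposition $S/I=\bigoplus_{i}u_iK[Z_i]$ with $|Z_i|\ge\operatorname{depth}(S/I)$ for all $i$), then $I^p$ is a Stanley ideal (i.e. $T/I^p$ has a Stanley decomposition $T/I^p=\bigoplus_i v_iK[W_i]$ with $|W_i|\ge\operatorname{depth}(T/I^p)$ for all $i$).
   Context: For a monomial ideal $J$ in a polynomial ring $R$ over $K$ with variable set $X$, a Stanley space is a $K$-subspace $uK[Z]$ of $R/J$, with $u$ a monomial and $Z\subseteq X$, spanned by all $uv$ with $v$ a monomial in $K[Z]$, which is a free $K[Z]$-module; a Stanley decomposition of $R/J$ is a decomposition of $R/J$ as a finite direct sum of Stanley spaces. Polarization: for a monomial $u=\prod_{i=1}^n x_i^{a_i}$, its polarization is $u^p=\prod_{i=1}^n\prod_{j=1}^{a_i}x_{ij}$. If $I$ is minimally generated by monomials $u_1,\ldots,u_s$, with $u_j=x_1^{a_{j1}}\cdots x_n^{a_{jn}}$, set $r_i=\max_j a_{ji}$; then $I^p=(u_1^p,\ldots,u_s^p)$ is an ideal of $T=K[x_{ij}: 1\le i\le n,\ 1\le j\le r_i]$. *)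

theory Defs
  imports "HOL-Algebra.QuotRing" "HOL-Library.Poly_Mapping" "HOL-Library.Extended_Nat"
begin

section \<open>Polynomial rings\<close>

text \<open>
  A monomial is (its exponent vector) \<open>u :: 'x \<Rightarrow>\<^sub>0 nat\<close>, and a polynomial over the field \<open>'k\<close> is a
  finitely supported function from monomials to \<open>'k\<close>, multiplied by convolution. The variable set
  \<open>X\<close> is a set rather than a type, because the polarization lives in a polynomial ring whose
  variables depend on the ideal.
\<close>

type_synonym ('x, 'k) mpoly = "('x \<Rightarrow>\<^sub>0 nat) \<Rightarrow>\<^sub>0 'k"

definition monomials :: "'x set \<Rightarrow> ('x \<Rightarrow>\<^sub>0 nat) set" where
  "monomials X = {u. Poly_Mapping.keys u \<subseteq> X}"

definition poly_ring :: "'x set \<Rightarrow> ('x, 'k::field) mpoly ring" where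
  "poly_ring X = \<lparr>carrier = {p. Poly_Mapping.keys p \<subseteq> monomials X},
     mult = (*), one = 1, zero = 0, add = (+)\<rparr>"

definition mon :: "('x \<Rightarrow>\<^sub>0 nat) \<Rightarrow> ('x, 'k::field) mpoly" where
  "mon u = Poly_Mapping.single u 1"

definition Var :: "'x \<Rightarrow> ('x, 'k::field) mpoly" where
  "Var x = mon (Poly_Mapping.single x 1)"

lemma carrier_poly_ring_iff:
  "p \<in> carrier (poly_ring X) \<longleftrightarrow> (\<forall>u\<in>Poly_Mapping.keys p. Poly_Mapping.keys u \<subseteq> X)"
  by (auto simp: poly_ring_def monomials_def)

lemma cring_poly_ring: "cring (poly_ring X :: ('x, 'k::field) mpoly ring)"
proof (rule cringI)
  show "abelian_group (poly_ring X :: ('x, 'k) mpoly ring)"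
  proof (rule abelian_groupI)
    fix p q :: "('x, 'k) mpoly"
    assume "p \<in> carrier (poly_ring X)" "q \<in> carrier (poly_ring X)"
    then show "p \<oplus>\<^bsub>poly_ring X\<^esub> q \<in> carrier (poly_ring X)"
      using keys_add[of p q] by (auto simp: poly_ring_def)
  next
    fix p :: "('x, 'k) mpoly"
    assume "p \<in> carrier (poly_ring X)"
    then show "\<exists>q\<in>carrier (poly_ring X). q \<oplus>\<^bsub>poly_ring X\<^esub> p = \<zero>\<^bsub>poly_ring X\<^esub>"
      by (intro bexI[of _ "- p"]) (auto simp: poly_ring_def)
  qed (auto simp: poly_ring_def algebra_simps)
  show "comm_monoid (poly_ring X :: ('x, 'k) mpoly ring)"
  proof (rule comm_monoidI)
    fix p q :: "('x, 'k) mpoly"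
    assume pq: "p \<in> carrier (poly_ring X)" "q \<in> carrier (poly_ring X)"
    have "Poly_Mapping.keys w \<subseteq> X" if w: "w \<in> Poly_Mapping.keys (p * q)" for w
    proof -
      obtain u v where "u \<in> Poly_Mapping.keys p" "v \<in> Poly_Mapping.keys q" "w = u + v"
        using w keys_mult[of p q] by blast
      with pq show ?thesis
        using keys_add[of u v] unfolding carrier_poly_ring_iff by blast
    qed
    then show "p \<otimes>\<^bsub>poly_ring X\<^esub> q \<in> carrier (poly_ring X)"
      unfolding carrier_poly_ring_iff by (simp add: poly_ring_def)
  qed (auto simp: poly_ring_def monomials_def algebra_simps)
qed (auto simp: poly_ring_def algebra_simps)

section \<open>Monomial ideals\<close>

definition monomial_ideal :: "'x set \<Rightarrow> ('x, 'k::field) mpoly set \<Rightarrow> bool" where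
  "monomial_ideal X J \<longleftrightarrow> (\<exists>M \<subseteq> monomials X. J = Idl\<^bsub>poly_ring X\<^esub> (mon ` M))"

definition minimally_generated ::
  "'x set \<Rightarrow> ('x, 'k::field) mpoly set \<Rightarrow> ('x \<Rightarrow>\<^sub>0 nat) set \<Rightarrow> bool" where
  "minimally_generated X J G \<longleftrightarrow> finite G \<and> G \<subseteq> monomials X \<and>
     J = Idl\<^bsub>poly_ring X\<^esub> (mon ` G) \<and> (\<forall>H. H \<subset> G \<longrightarrow> J \<noteq> Idl\<^bsub>poly_ring X\<^esub> (mon ` H))"

section \<open>Depth, Krull dimension, Cohen--Macaulay quotients\<close>

definition graded_max_ideal :: "'x set \<Rightarrow> ('x, 'k::field) mpoly set" where
  "graded_max_ideal X = Idl\<^bsub>poly_ring X\<^esub> (Var ` X)"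

text \<open>
  \<open>f\<^sub>1, \<dots>, f\<^sub>k\<close> is a regular sequence on the \<open>R\<close>-module \<open>M = R/J\<close>: each \<open>f\<^sub>i\<close> is a nonzerodivisor on
  \<open>M/(f\<^sub>1, \<dots>, f\<^sub>i\<^sub>-\<^sub>1)M = R/(J + (f\<^sub>1, \<dots>, f\<^sub>i\<^sub>-\<^sub>1))\<close>, and \<open>M/(f\<^sub>1, \<dots>, f\<^sub>k)M \<noteq> 0\<close>.
\<close>
definition regular_sequence :: "('a, 'm) ring_scheme \<Rightarrow> 'a set \<Rightarrow> 'a list \<Rightarrow> bool" where
  "regular_sequence R J fs \<longleftrightarrow> set fs \<subseteq> carrier R \<and>
     (\<forall>i < length fs. \<forall>a \<in> carrier R.
        fs ! i \<otimes>\<^bsub>R\<^esub> a \<in> Idl\<^bsub>R\<^esub> (J \<union> set (take i fs)) \<longrightarrow> a \<in> Idl\<^bsub>R\<^esub> (J \<union> set (take i fs))) \<and>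
     Idl\<^bsub>R\<^esub> (J \<union> set fs) \<noteq> carrier R"

text \<open>
  The depth of \<open>R/J\<close> for \<open>R = K[X]\<close> is taken with respect to the graded maximal ideal \<open>(X)\<close>; the
  zero module has depth \<open>\<infinity>\<close>.
\<close>
definition depth_quot :: "'x set \<Rightarrow> ('x, 'k::field) mpoly set \<Rightarrow> enat" where
  "depth_quot X J = (if J = carrier (poly_ring X) then \<infinity> else
     Sup {enat (length fs) | fs. set fs \<subseteq> graded_max_ideal X \<and> regular_sequence (poly_ring X) J fs})"

definition krull_dim :: "('a, 'm) ring_scheme \<Rightarrow> enat" where
  "krull_dim A = Sup {enat k | k.
     \<exists>P. (\<forall>i \<le> k. primeideal (P i) A) \<and> (\<forall>i < k. P i \<subset> P (Suc i))}"

definition cohen_macaulay_quot :: "'x set \<Rightarrow> ('x, 'k::field) mpoly set \<Rightarrow> bool" where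
  "cohen_macaulay_quot X J \<longleftrightarrow>
     J \<noteq> carrier (poly_ring X) \<and> depth_quot X J = krull_dim (poly_ring X Quot J)"

section \<open>Stanley decompositions\<close>

text \<open>The subspace \<open>u K[Z]\<close> of \<open>K[X]/J\<close>: the \<open>K\<close>-span of the classes of \<open>u v\<close>, \<open>v\<close> a monomial in \<open>K[Z]\<close>.\<close>
definition monomial_space ::
  "'x set \<Rightarrow> ('x, 'k::field) mpoly set \<Rightarrow> ('x \<Rightarrow>\<^sub>0 nat) \<Rightarrow> 'x set \<Rightarrow> ('x, 'k) mpoly set set" where
  "monomial_space X J u Z = {J +>\<^bsub>poly_ring X\<^esub> (mon u * q) | q. q \<in> carrier (poly_ring Z)}"

text \<open>The last condition says that \<open>u K[Z]\<close> is a free \<open>K[Z]\<close>-module, with basis the class of \<open>u\<close>.\<close>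
definition is_stanley_space ::
  "'x set \<Rightarrow> ('x, 'k::field) mpoly set \<Rightarrow> ('x \<Rightarrow>\<^sub>0 nat) \<Rightarrow> 'x set \<Rightarrow> bool" where
  "is_stanley_space X J u Z \<longleftrightarrow> u \<in> monomials X \<and> Z \<subseteq> X \<and>
     (\<forall>q \<in> carrier (poly_ring Z).
        J +>\<^bsub>poly_ring X\<^esub> (mon u * q) = \<zero>\<^bsub>poly_ring X Quot J\<^esub> \<longrightarrow> q = 0)"

text \<open>\<open>A\<close> is the internal direct sum of the finite family \<open>V\<close> of additive subgroups.\<close>
definition finite_direct_sum :: "('a, 'm) ring_scheme \<Rightarrow> 'i set \<Rightarrow> ('i \<Rightarrow> 'a set) \<Rightarrow> bool" where
  "finite_direct_sum A D V \<longleftrightarrow> finite D \<and> (\<forall>i\<in>D. additive_subgroup (V i) A) \<and>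
     (\<forall>a \<in> carrier A. \<exists>!f. f \<in> Pi\<^sub>E D V \<and> a = (\<Oplus>\<^bsub>A\<^esub> i\<in>D. f i))"

definition stanley_decomposition ::
  "'x set \<Rightarrow> ('x, 'k::field) mpoly set \<Rightarrow> (('x \<Rightarrow>\<^sub>0 nat) \<times> 'x set) set \<Rightarrow> bool" where
  "stanley_decomposition X J D \<longleftrightarrow> (\<forall>(u, Z) \<in> D. is_stanley_space X J u Z) \<and>
     finite_direct_sum (poly_ring X Quot J) D (\<lambda>(u, Z). monomial_space X J u Z)"

definition stanley_ideal :: "'x set \<Rightarrow> ('x, 'k::field) mpoly set \<Rightarrow> bool" where
  "stanley_ideal X J \<longleftrightarrow> (\<exists>D. stanley_decomposition X J D \<and>
     (\<forall>(u, Z) \<in> D. depth_quot X J \<le> enat (card Z)))"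

section \<open>Polarization\<close>

text \<open>
  The variables of \<open>S\<close> are \<open>1, \<dots>, n\<close>, and the variable \<open>x\<^sub>i\<^sub>j\<close> of \<open>T\<close> is the pair \<open>(i, j)\<close>. The set
  \<open>G\<close> is the minimal monomial generating set \<open>u\<^sub>1, \<dots>, u\<^sub>s\<close>; for \<open>s = 0\<close> all \<open>r\<^sub>i\<close> are \<open>0\<close>.
\<close>

definition max_exponent :: "(nat \<Rightarrow>\<^sub>0 nat) set \<Rightarrow> nat \<Rightarrow> nat" where
  "max_exponent G i = Max (insert 0 ((\<lambda>u. Poly_Mapping.lookup u i) ` G))"

definition polar_vars :: "nat \<Rightarrow> (nat \<Rightarrow>\<^sub>0 nat) set \<Rightarrow> (nat \<times> nat) set" where
  "polar_vars n G = {(i, j). 1 \<le> i \<and> i \<le> n \<and> 1 \<le> j \<and> j \<le> max_exponent G i}"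

definition polar_mon :: "nat \<Rightarrow> (nat \<Rightarrow>\<^sub>0 nat) \<Rightarrow> (nat \<times> nat, 'k::field) mpoly" where
  "polar_mon n u = (\<Prod>i = 1..n. \<Prod>j = 1..Poly_Mapping.lookup u i. Var (i, j))"

definition polarization :: "nat \<Rightarrow> (nat \<Rightarrow>\<^sub>0 nat) set \<Rightarrow> (nat \<times> nat, 'k::field) mpoly set" where
  "polarization n G = Idl\<^bsub>poly_ring (polar_vars n G)\<^esub> (polar_mon n ` G)"

end

theory Submission
  imports Defs
begin

text \<open>
  For a monomial \<open>v\<close> of \<open>T\<close> let \<open>b(v)\<^sub>i\<close> be the largest \<open>b\<close> such that \<open>x\<^sub>i\<^sub>1, \<dots>, x\<^sub>i\<^sub>b\<close> all divide \<open>v\<close>. Then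
  \<open>v \<in> I\<^sup>p\<close> iff \<open>x\<^bsup>b(v)\<^esup> \<in> I\<close>, and the preimage under \<open>b\<close> of the monomials of a Stanley space \<open>u K[Z]\<close> is
  either empty (when \<open>u\<close> exceeds some \<open>r\<^sub>i\<close>) or the set of monomials of \<open>u\<^sup>p K[W]\<close>, where \<open>W\<close> omits
  only the variables \<open>x\<^sub>i\<^sub>j\<close> with \<open>i \<notin> Z\<close> and \<open>j = u\<^sub>i + 1\<close>. So a Stanley decomposition of \<open>S/I\<close> pulls
  back to one of \<open>T/I\<^sup>p\<close>, with \<open>|W| \<ge> |Z| + dim T - n\<close>.

  For the depth, a regular sequence on \<open>T/I\<^sup>p\<close> is algebraically independent modulo \<open>I\<^sup>p\<close>, so by counting
  monomials its length is at most the size of some set \<open>F\<close> of variables with \<open>I\<^sup>p \<inter> K[F] = 0\<close>; such an \<open>F\<close> yields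
  \<open>Z'\<close> with \<open>I \<inter> K[Z'] = 0\<close> and \<open>|F| \<le> |Z'| + dim T - n\<close>. Finally \<open>|Z'| \<le> dim S/I\<close>, which equals
  \<open>depth S/I \<le> |Z|\<close> by the Cohen--Macaulay hypothesis.
\<close>

abbreviation lookup :: "('a \<Rightarrow>\<^sub>0 'b::zero) \<Rightarrow> 'a \<Rightarrow> 'b" where
  "lookup \<equiv> Poly_Mapping.lookup"

abbreviation keys :: "('a \<Rightarrow>\<^sub>0 'b::zero) \<Rightarrow> 'a set" where
  "keys \<equiv> Poly_Mapping.keys"

section \<open>Monomials and monomial ideals\<close>

lemma poly_ring_simps [simp]:
  "mult (poly_ring X) = (*)" "one (poly_ring X) = 1"
  "zero (poly_ring X) = 0" "add (poly_ring X) = (+)"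
  by (simp_all add: poly_ring_def)

lemma ring_poly_ring: "ring (poly_ring X :: ('x, 'k::field) mpoly ring)"
  using cring_poly_ring cring.axioms(1) by blast

lemma a_inv_poly_ring [simp]:
  fixes p :: "('x, 'k::field) mpoly"
  assumes "p \<in> carrier (poly_ring X)"
  shows "\<ominus>\<^bsub>poly_ring X\<^esub> p = - p"
proof -
  interpret R: ring "poly_ring X :: ('x, 'k) mpoly ring" by (rule ring_poly_ring)
  have "- p \<in> carrier (poly_ring X)"
    using assms by (simp add: carrier_poly_ring_iff)
  then show ?thesis
    using assms by (intro R.minus_equality) auto
qed

lemma finsum_poly_ring:
  assumes "finite A" "\<And>i. i \<in> A \<Longrightarrow> f i \<in> carrier (poly_ring X :: ('x, 'k::field) mpoly ring)"
  shows "finsum (poly_ring X) f A = sum f A"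
proof -
  interpret R: ring "poly_ring X :: ('x, 'k) mpoly ring" by (rule ring_poly_ring)
  from assms show ?thesis
    by (induction A) (auto simp: R.finsum_insert Pi_iff)
qed

lemma sum_poly_ring_closed:
  assumes "finite A" "\<And>i. i \<in> A \<Longrightarrow> f i \<in> carrier (poly_ring X :: ('x, 'k::field) mpoly ring)"
  shows "sum f A \<in> carrier (poly_ring X)"
proof -
  interpret R: ring "poly_ring X :: ('x, 'k) mpoly ring" by (rule ring_poly_ring)
  have "finsum (poly_ring X) f A \<in> carrier (poly_ring X)"
    using assms by (intro R.finsum_closed) auto
  then show ?thesis
    by (simp only: finsum_poly_ring[OF assms])
qed

lemma mult_poly_ring_closed:
  fixes p q :: "('x, 'k::field) mpoly"
  assumes "p \<in> carrier (poly_ring X)" "q \<in> carrier (poly_ring X)"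
  shows "p * q \<in> carrier (poly_ring X)"
proof -
  interpret R: ring "poly_ring X :: ('x, 'k) mpoly ring" by (rule ring_poly_ring)
  show ?thesis using R.m_closed[OF assms] by simp
qed

lemma diff_poly_ring_closed:
  fixes p q :: "('x, 'k::field) mpoly"
  assumes "p \<in> carrier (poly_ring X)" "q \<in> carrier (poly_ring X)"
  shows "p - q \<in> carrier (poly_ring X)"
  using assms keys_diff[of p q] unfolding carrier_poly_ring_iff by blast

section \<open>Divisibility of exponent vectors and membership in monomial ideals\<close>

lemma keys_mon [simp]: "keys (mon u :: ('x, 'k::field) mpoly) = {u}"
  by (simp add: mon_def)

lemma mon_nonzero [simp]: "(mon u :: ('x, 'k::field) mpoly) \<noteq> 0"
  by (metis keys_mon keys_zero insert_not_empty)

lemma mon_mult: "(mon u * mon v :: ('x, 'k::field) mpoly) = mon (u + v)"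
  by (simp add: mon_def mult_single)

lemma mon_closed_iff [simp]:
  "(mon u :: ('x, 'k::field) mpoly) \<in> carrier (poly_ring X) \<longleftrightarrow> u \<in> monomials X"
  by (simp add: carrier_poly_ring_iff monomials_def)

lemma monomials_add_iff: "u + v \<in> monomials X \<longleftrightarrow> u \<in> monomials X \<and> v \<in> monomials X"
  by (force simp: monomials_def subset_iff in_keys_iff lookup_add)

definition monomial_dvd :: "('x \<Rightarrow>\<^sub>0 nat) \<Rightarrow> ('x \<Rightarrow>\<^sub>0 nat) \<Rightarrow> bool" where
  "monomial_dvd u w \<longleftrightarrow> (\<forall>x. lookup u x \<le> lookup w x)"

lemma monomial_dvd_iff_ex: "monomial_dvd u w \<longleftrightarrow> (\<exists>v. w = u + v)"
proof
  assume "monomial_dvd u w"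
  then have "w = u + (w - u)"
    by (intro poly_mapping_eqI) (simp add: monomial_dvd_def lookup_add lookup_minus)
  then show "\<exists>v. w = u + v" by blast
qed (auto simp: monomial_dvd_def lookup_add)

text \<open>No variable set is fixed: intersected with \<open>monomials X\<close>, this is the set
  of monomials of the ideal of \<open>K[X]\<close> generated by
  \<open>M \<subseteq> monomials X\<close>.\<close>

definition multiples :: "('x \<Rightarrow>\<^sub>0 nat) set \<Rightarrow> ('x \<Rightarrow>\<^sub>0 nat) set" where
  "multiples M = {w. \<exists>m\<in>M. monomial_dvd m w}"

lemma add_mem_multiples: "w \<in> multiples M \<Longrightarrow> v + w \<in> multiples M"
  by (force simp: multiples_def monomial_dvd_def lookup_add intro: trans_le_add2)

lemma sum_single_keys: "(\<Sum>w\<in>keys p. Poly_Mapping.single w (lookup p w)) = p"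
  by (rule poly_mapping_eqI)
    (auto simp: lookup_sum lookup_single when_def sum.delta in_keys_iff)

text \<open>Polynomials supported on \<open>multiples M\<close> form an ideal containing the
  generators; conversely every term of such a polynomial is a generator times a term. Ideal
  membership thereby becomes a condition on exponents.\<close>

lemma mem_monomial_ideal_iff:
  fixes p :: "('x, 'k::field) mpoly"
  assumes M: "M \<subseteq> monomials X"
  shows "p \<in> Idl\<^bsub>poly_ring X\<^esub> (mon ` M) \<longleftrightarrow>
    p \<in> carrier (poly_ring X) \<and> keys p \<subseteq> multiples M"
proof
  interpret R: cring "poly_ring X :: ('x, 'k) mpoly ring" by (rule cring_poly_ring)
  let ?I = "{p :: ('x, 'k) mpoly. p \<in> carrier (poly_ring X) \<and> keys p \<subseteq> multiples M}"
  have mult: "q * p \<in> ?I" if "p \<in> ?I" "q \<in> carrier (poly_ring X)" for p q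
    using that keys_mult[of q p] by (auto intro: mult_poly_ring_closed add_mem_multiples)
  have "ideal ?I (poly_ring X)"
  proof (rule idealI)
    show "ring (poly_ring X :: ('x, 'k) mpoly ring)" by (rule ring_poly_ring)
    show "subgroup ?I (add_monoid (poly_ring X))"
    proof (rule R.add.subgroupI)
      fix p assume "p \<in> ?I"
      then show "\<ominus>\<^bsub>poly_ring X\<^esub> p \<in> ?I"
        by (simp add: carrier_poly_ring_iff)
    next
      fix p q assume "p \<in> ?I" "q \<in> ?I"
      then show "p \<oplus>\<^bsub>poly_ring X\<^esub> q \<in> ?I"
        using keys_add[of p q] by (simp add: carrier_poly_ring_iff) blast
    next
      show "?I \<noteq> {}" by (auto intro!: exI[of _ 0] simp: carrier_poly_ring_iff)
    qed auto
    show "q \<otimes>\<^bsub>poly_ring X\<^esub> p \<in> ?I" if "p \<in> ?I" "q \<in> carrier (poly_ring X)" for p q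
      using mult[OF that] by simp
    show "p \<otimes>\<^bsub>poly_ring X\<^esub> q \<in> ?I" if "p \<in> ?I" "q \<in> carrier (poly_ring X)" for p q
      using mult[OF that] by (simp add: mult.commute)
  qed
  moreover have "mon ` M \<subseteq> ?I"
    using M by (auto simp: multiples_def monomial_dvd_def)
  ultimately have sub: "Idl\<^bsub>poly_ring X\<^esub> (mon ` M) \<subseteq> ?I"
    by (rule R.genideal_minimal)
  show "p \<in> carrier (poly_ring X) \<and> keys p \<subseteq> multiples M"
    if "p \<in> Idl\<^bsub>poly_ring X\<^esub> (mon ` M)"
    using sub that by blast
  have M': "mon ` M \<subseteq> carrier (poly_ring X :: ('x, 'k) mpoly ring)"
    using M by auto
  interpret I: ideal "Idl\<^bsub>poly_ring X\<^esub> (mon ` M)" "poly_ring X :: ('x, 'k) mpoly ring"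
    using M' by (rule R.genideal_ideal)
  assume p: "p \<in> carrier (poly_ring X) \<and> keys p \<subseteq> multiples M"
  have term_in: "Poly_Mapping.single w (lookup p w) \<in> Idl\<^bsub>poly_ring X\<^esub> (mon ` M)" if w: "w \<in> keys p" for w
  proof -
    obtain m v where m: "m \<in> M" and w_eq: "w = m + v"
      using p w by (auto simp: multiples_def monomial_dvd_iff_ex)
    have "w \<in> monomials X"
      using p w by (auto simp: carrier_poly_ring_iff monomials_def)
    then have v: "v \<in> monomials X"
      by (simp add: w_eq monomials_add_iff)
    have "mon m \<in> Idl\<^bsub>poly_ring X\<^esub> (mon ` M :: ('x, 'k) mpoly set)"
      using R.genideal_self[OF M'] m by blast
    moreover have "Poly_Mapping.single v (lookup p w) \<in> carrier (poly_ring X)"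
      using v by (simp add: carrier_poly_ring_iff monomials_def)
    ultimately have "mon m \<otimes>\<^bsub>poly_ring X\<^esub> Poly_Mapping.single v (lookup p w)
        \<in> Idl\<^bsub>poly_ring X\<^esub> (mon ` M)"
      by (rule I.I_r_closed)
    then show ?thesis
      by (simp add: w_eq mon_def mult_single)
  qed
  have "(\<Sum>w\<in>A. Poly_Mapping.single w (lookup p w)) \<in> Idl\<^bsub>poly_ring X\<^esub> (mon ` M)"
    if "finite A" "A \<subseteq> keys p" for A
    using that
  proof (induction A)
    case empty
    show ?case using I.zero_closed by simp
  next
    case (insert w A)
    then show ?case
      using I.a_closed[OF term_in[of w], of "\<Sum>w\<in>A. Poly_Mapping.single w (lookup p w)"] by simp
  qed
  from this[of "keys p"] show "p \<in> Idl\<^bsub>poly_ring X\<^esub> (mon ` M)"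
    by (simp add: sum_single_keys)
qed

lemma ideal_monomial_ideal:
  assumes "M \<subseteq> monomials X"
  shows "ideal (Idl\<^bsub>poly_ring X\<^esub> (mon ` M)) (poly_ring X :: ('x, 'k::field) mpoly ring)"
proof -
  interpret R: ring "poly_ring X :: ('x, 'k) mpoly ring" by (rule ring_poly_ring)
  show ?thesis using assms by (intro R.genideal_ideal) auto
qed

section \<open>Cosets and sums in a quotient of the polynomial ring\<close>

lemma coset_eq_iff:
  fixes p q :: "('x, 'k::field) mpoly"
  assumes J: "ideal J (poly_ring X)" and p: "p \<in> carrier (poly_ring X)" and q: "q \<in> carrier (poly_ring X)"
  shows "J +>\<^bsub>poly_ring X\<^esub> p = J +>\<^bsub>poly_ring X\<^esub> q \<longleftrightarrow> p - q \<in> J"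
proof -
  interpret R: ring "poly_ring X :: ('x, 'k) mpoly ring" by (rule ring_poly_ring)
  interpret J: ideal J "poly_ring X" by (rule J)
  have "p - q \<in> J \<longleftrightarrow> p \<in> J +>\<^bsub>poly_ring X\<^esub> q"
    using J.a_rcos_module_minus[OF ring_poly_ring q p] q by (simp add: a_minus_def)
  then show ?thesis
    using J.a_rcos_self[OF p] J.a_repr_independence'[of p q] q by auto
qed

lemma coset_eq_zero_iff:
  fixes p :: "('x, 'k::field) mpoly"
  assumes J: "ideal J (poly_ring X)" and p: "p \<in> carrier (poly_ring X)"
  shows "J +>\<^bsub>poly_ring X\<^esub> p = J \<longleftrightarrow> p \<in> J"
proof -
  interpret R: ring "poly_ring X :: ('x, 'k) mpoly ring" by (rule ring_poly_ring)
  interpret J: ideal J "poly_ring X" by (rule J)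
  have "J +>\<^bsub>poly_ring X\<^esub> 0 = J"
    using R.a_coset_add_zero[OF J.a_subset] by simp
  then show ?thesis
    using coset_eq_iff[OF J p, of 0] R.zero_closed by simp
qed

lemma carrier_Quot: "carrier (R Quot J) = (\<lambda>a. J +>\<^bsub>R\<^esub> a) ` carrier R"
  by (auto simp: FactRing_def A_RCOSETS_def')

lemma zero_Quot [simp]: "zero (R Quot J) = J"
  by (simp add: FactRing_def)

lemma finsum_Quot:
  fixes p :: "'i \<Rightarrow> ('x, 'k::field) mpoly"
  assumes J: "ideal J (poly_ring X)" and "finite A" "\<And>i. i \<in> A \<Longrightarrow> p i \<in> carrier (poly_ring X)"
  shows "finsum (poly_ring X Quot J) (\<lambda>i. J +>\<^bsub>poly_ring X\<^esub> p i) A = J +>\<^bsub>poly_ring X\<^esub> (\<Sum>i\<in>A. p i)"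
proof -
  interpret h: ring_hom_cring "poly_ring X" "poly_ring X Quot J" "(+>\<^bsub>poly_ring X\<^esub>) J"
    using J cring_poly_ring by (rule ideal.rcos_ring_hom_cring)
  have "J +>\<^bsub>poly_ring X\<^esub> finsum (poly_ring X) p A
      = finsum (poly_ring X Quot J) ((+>\<^bsub>poly_ring X\<^esub>) J \<circ> p) A"
    using assms by (intro h.hom_finsum) auto
  then show ?thesis
    using finsum_poly_ring[OF assms(2,3)] by (simp add: o_def)
qed

section \<open>Stanley decompositions as partitions into cones\<close>

definition cone :: "('x \<Rightarrow>\<^sub>0 nat) \<Rightarrow> 'x set \<Rightarrow> ('x \<Rightarrow>\<^sub>0 nat) set" where
  "cone u Z = (+) u ` monomials Z"

lemma mem_cone_iff:
  "w \<in> cone u Z \<longleftrightarrow> (\<forall>x. lookup u x \<le> lookup w x) \<and> (\<forall>x. x \<notin> Z \<longrightarrow> lookup w x = lookup u x)"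
proof
  assume R: "(\<forall>x. lookup u x \<le> lookup w x) \<and> (\<forall>x. x \<notin> Z \<longrightarrow> lookup w x = lookup u x)"
  then have "w = u + (w - u)"
    by (intro poly_mapping_eqI) (simp add: lookup_add lookup_minus)
  moreover have "w - u \<in> monomials Z"
    using R by (force simp: monomials_def in_keys_iff lookup_minus)
  ultimately show "w \<in> cone u Z"
    unfolding cone_def by blast
next
  assume "w \<in> cone u Z"
  then obtain v where "w = u + v" "keys v \<subseteq> Z"
    by (auto simp: cone_def monomials_def)
  then show "(\<forall>x. lookup u x \<le> lookup w x) \<and> (\<forall>x. x \<notin> Z \<longrightarrow> lookup w x = lookup u x)"
    by (auto simp: lookup_add in_keys_iff subset_iff)
qed

lemma cone_subset_monomials: "u \<in> monomials X \<Longrightarrow> Z \<subseteq> X \<Longrightarrow> cone u Z \<subseteq> monomials X"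
  by (auto simp: cone_def monomials_add_iff) (auto simp: monomials_def)

lemma lookup_mon_mult_add:
  "lookup (mon u * q :: ('x, 'k::field) mpoly) (u + v) = lookup q v"
proof -
  have "lookup (mon u * q) (u + v) = lookup (\<Sum>w\<in>keys q. mon u * Poly_Mapping.single w (lookup q w)) (u + v)"
    by (simp add: sum_single_keys flip: sum_distrib_left)
  also have "\<dots> = (\<Sum>w\<in>keys q. if w = v then lookup q w else 0)"
    unfolding lookup_sum mon_def mult_single
    by (intro sum.cong) (auto simp: lookup_single when_def)
  also have "\<dots> = lookup q v"
    by (auto simp: in_keys_iff)
  finally show ?thesis .
qed

lemma keys_mon_mult: "keys (mon u * q :: ('x, 'k::field) mpoly) = (+) u ` keys q"
proof
  show "keys (mon u * q) \<subseteq> (+) u ` keys q"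
    using keys_mult[of "mon u" q] by auto
  show "(+) u ` keys q \<subseteq> keys (mon u * q)"
    by (auto simp: in_keys_iff lookup_mon_mult_add)
qed

text \<open>Multiplication by \<open>mon u\<close> shifts supports by \<open>u\<close>; a polynomial
  supported on the cone is shifted back by \<open>map_key\<close>, because adding \<open>u\<close>
  is injective.\<close>

lemma mon_mult_image:
  "{mon u * q | q. q \<in> carrier (poly_ring Z)} = {p :: ('x, 'k::field) mpoly. keys p \<subseteq> cone u Z}"
proof (intro Set.equalityI subsetI)
  fix p :: "('x, 'k) mpoly"
  assume p: "p \<in> {p. keys p \<subseteq> cone u Z}"
  have inj: "inj ((+) u)" by (simp add: inj_def)
  define q where "q = Poly_Mapping.map_key ((+) u) p"
  have lq: "lookup q v = lookup p (u + v)" for v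
    unfolding q_def by (subst map_key.rep_eq[OF inj]) simp
  have "lookup p w = lookup (mon u * q) w" for w
  proof (cases "\<exists>v. w = u + v")
    case True
    then show ?thesis by (auto simp: lookup_mon_mult_add lq)
  next
    case False
    then have "w \<notin> keys p" using p by (auto simp: cone_def)
    moreover have "w \<notin> keys (mon u * q)" using False by (auto simp: keys_mon_mult)
    ultimately show ?thesis by (simp add: in_keys_iff)
  qed
  then have "p = mon u * q" by (rule poly_mapping_eqI)
  moreover have "q \<in> carrier (poly_ring Z)"
    unfolding carrier_poly_ring_iff
  proof
    fix v assume "v \<in> keys q"
    then have "u + v \<in> cone u Z" using p by (auto simp: in_keys_iff lq)
    then show "keys v \<subseteq> Z" by (auto simp: cone_def monomials_def)
  qed
  ultimately show "p \<in> {mon u * q | q. q \<in> carrier (poly_ring Z)}" by blast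
qed (auto simp: keys_mon_mult cone_def carrier_poly_ring_iff monomials_def)

lemma monomial_space_eq:
  "monomial_space X J u Z =
    (\<lambda>p. J +>\<^bsub>poly_ring X\<^esub> p) ` {p :: ('x, 'k::field) mpoly. keys p \<subseteq> cone u Z}"
  unfolding monomial_space_def mon_mult_image[symmetric] by auto

text \<open>Distinct \<open>v\<close> give distinct \<open>u + v\<close>, so nothing cancels:
  \<open>mon u * q\<close> lies in \<open>J\<close> iff each of its shifted monomials does. Freeness
  can thus only fail at a point of the cone lying in \<open>multiples M\<close>.\<close>

lemma is_stanley_space_iff:
  fixes J :: "('x, 'k::field) mpoly set"
  assumes M: "M \<subseteq> monomials X" and J: "J = Idl\<^bsub>poly_ring X\<^esub> (mon ` M)"
  shows "is_stanley_space X J u Z \<longleftrightarrow>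
    u \<in> monomials X \<and> Z \<subseteq> X \<and> cone u Z \<inter> multiples M = {}"
proof -
  have id: "ideal J (poly_ring X)" unfolding J by (rule ideal_monomial_ideal[OF M])
  have "(\<forall>q \<in> carrier (poly_ring Z). J +>\<^bsub>poly_ring X\<^esub> (mon u * q) = J \<longrightarrow> q = 0)
      \<longleftrightarrow> cone u Z \<inter> multiples M = {}" (is "?L \<longleftrightarrow> _") if uZ: "u \<in> monomials X" "Z \<subseteq> X"
  proof -
    have mem: "J +>\<^bsub>poly_ring X\<^esub> (mon u * q) = J \<longleftrightarrow> (+) u ` keys q \<subseteq> multiples M"
      if q: "q \<in> carrier (poly_ring Z)" for q :: "('x, 'k) mpoly"
    proof -
      have "mon u * q \<in> carrier (poly_ring X)"
        using q uZ by (intro mult_poly_ring_closed) (auto simp: carrier_poly_ring_iff monomials_def)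
      then show ?thesis
        unfolding coset_eq_zero_iff[OF id \<open>mon u * q \<in> _\<close>] by (simp add: J mem_monomial_ideal_iff[OF M] keys_mon_mult)
    qed
    show ?thesis
    proof
      assume L: ?L
      show "cone u Z \<inter> multiples M = {}"
      proof (rule ccontr)
        assume "cone u Z \<inter> multiples M \<noteq> {}"
        then obtain v where v: "v \<in> monomials Z" "u + v \<in> multiples M"
          by (auto simp: cone_def)
        then have "(mon v :: ('x, 'k) mpoly) = 0"
          using L mem[of "mon v"] by (auto simp del: mon_nonzero)
        then show False by simp
      qed
    next
      assume C: "cone u Z \<inter> multiples M = {}"
      show ?L
      proof (intro ballI impI)
        fix q :: "('x, 'k) mpoly"
        assume q: "q \<in> carrier (poly_ring Z)" "J +>\<^bsub>poly_ring X\<^esub> (mon u * q) = J"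
        then have "(+) u ` keys q \<subseteq> cone u Z \<inter> multiples M"
          using mem[of q] by (auto simp: cone_def carrier_poly_ring_iff monomials_def)
        then show "q = 0" using C by simp
      qed
    qed
  qed
  then show ?thesis unfolding is_stanley_space_def by auto
qed

text \<open>Used with \<open>B\<close> the monomials outside a monomial ideal, whose classes are a
  \<open>K\<close>-basis of the quotient.\<close>

definition cone_partition :: "('x \<Rightarrow>\<^sub>0 nat) set \<Rightarrow> (('x \<Rightarrow>\<^sub>0 nat) \<times> 'x set) set \<Rightarrow> bool" where
  "cone_partition B D \<longleftrightarrow> finite D \<and> (\<forall>(u, Z)\<in>D. cone u Z \<subseteq> B) \<and>
     (\<forall>w\<in>B. \<exists>!d. d \<in> D \<and> w \<in> cone (fst d) (snd d))"

text \<open>Monomials outside \<open>J\<close> have linearly independent classes. Expanding the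
  class of such a monomial shows that some cone contains it; were it in two cones, its class would
  have two expansions.\<close>

lemma cone_partition_of_stanley_decomposition:
  fixes J :: "('x, 'k::field) mpoly set"
  assumes M: "M \<subseteq> monomials X" and J: "J = Idl\<^bsub>poly_ring X\<^esub> (mon ` M)"
    and D: "stanley_decomposition X J D"
  shows "cone_partition (monomials X - multiples M) D"
proof -
  have id: "ideal J (poly_ring X)" unfolding J by (rule ideal_monomial_ideal[OF M])
  interpret Q: cring "poly_ring X Quot J"
    using id cring_poly_ring by (rule ideal.quotient_is_cring)
  let ?cls = "\<lambda>p. J +>\<^bsub>poly_ring X\<^esub> p"
  let ?V = "\<lambda>(u, Z). monomial_space X J u Z"
  have fin: "finite D"
    and dec: "\<And>a. a \<in> carrier (poly_ring X Quot J) \<Longrightarrow>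
      \<exists>!f. f \<in> Pi\<^sub>E D ?V \<and> a = finsum (poly_ring X Quot J) f D"
    using D by (auto simp: stanley_decomposition_def finite_direct_sum_def)
  have space: "u \<in> monomials X" "Z \<subseteq> X" "cone u Z \<inter> multiples M = {}" if "(u, Z) \<in> D" for u Z
    using D that is_stanley_space_iff[OF M J] by (auto simp: stanley_decomposition_def)
  have sub: "cone u Z \<subseteq> monomials X - multiples M" if "(u, Z) \<in> D" for u Z
    using space[OF that] cone_subset_monomials[of u X Z] by blast
  have ex: "\<exists>d. d \<in> D \<and> w \<in> cone (fst d) (snd d)" if w: "w \<in> monomials X - multiples M" for w
  proof (rule ccontr)
    assume neg: "\<not> ?thesis"
    have wc: "(mon w :: ('x, 'k) mpoly) \<in> carrier (poly_ring X)" using w by simp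
    have ac: "?cls (mon w) \<in> carrier (poly_ring X Quot J)"
      using wc unfolding carrier_Quot by (rule imageI)
    obtain f where f: "f \<in> Pi\<^sub>E D ?V" "?cls (mon w) = finsum (poly_ring X Quot J) f D"
      using ex1_implies_ex[OF dec[OF ac]] by (elim exE conjE)
    have "\<exists>p. keys p \<subseteq> cone (fst d) (snd d) \<and> f d = ?cls p" if "d \<in> D" for d
    proof -
      have "f d \<in> ?V d" using f(1) that by (rule PiE_mem)
      then show ?thesis by (cases d) (auto simp: monomial_space_eq)
    qed
    then obtain p where p: "\<And>d. d \<in> D \<Longrightarrow> keys (p d) \<subseteq> cone (fst d) (snd d) \<and> f d = ?cls (p d)"
      by metis
    have pc: "p d \<in> carrier (poly_ring X)" if "d \<in> D" for d
      using p[OF that] sub[of "fst d" "snd d"] that by (auto simp: carrier_poly_ring_iff monomials_def)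
    have "finsum (poly_ring X Quot J) f D = finsum (poly_ring X Quot J) (\<lambda>d. ?cls (p d)) D"
      using p pc by (intro Q.finsum_cong') (auto simp: carrier_Quot)
    also have "\<dots> = ?cls (sum p D)"
      by (rule finsum_Quot[OF id fin pc])
    finally have "mon w - sum p D \<in> J"
      using f(2) coset_eq_iff[OF id wc sum_poly_ring_closed[OF fin pc]] by simp
    \<comment> \<open>Every summand vanishes at the uncovered \<open>w\<close>, so the coefficient
      there is \<open>1\<close>, while elements of \<open>J\<close> have no monomial outside
      \<open>multiples M\<close>.\<close>
    moreover have "w \<in> keys (mon w - sum p D)"
    proof -
      have "lookup (p d) w = 0" if "d \<in> D" for d
        using p[OF that] neg that by (auto simp: in_keys_iff)
      then have "lookup (sum p D) w = 0" by (simp add: lookup_sum)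
      then show ?thesis by (simp add: in_keys_iff lookup_minus mon_def)
    qed
    ultimately show False
      using w by (auto simp: J mem_monomial_ideal_iff[OF M])
  qed
  have un: "d = e" if w: "w \<in> monomials X - multiples M"
    and d: "d \<in> D" "w \<in> cone (fst d) (snd d)" and e: "e \<in> D" "w \<in> cone (fst e) (snd e)" for w d e
  proof (rule ccontr)
    assume ne: "d \<noteq> e"
    have wc: "(mon w :: ('x, 'k) mpoly) \<in> carrier (poly_ring X)" using w by simp
    let ?a = "?cls (mon w)"
    have ac: "?a \<in> carrier (poly_ring X Quot J)"
      using wc unfolding carrier_Quot by (rule imageI)
    have zc: "J \<in> carrier (poly_ring X Quot J)" using Q.zero_closed by simp
    \<comment> \<open>The expansion concentrated at index \<open>d\<close>; the coset
      \<open>J\<close> is the zero of the quotient.\<close>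
    define g where "g d = (\<lambda>i\<in>D. if i = d then ?a else J)" for d
    have g: "g d \<in> Pi\<^sub>E D ?V \<and> ?a = finsum (poly_ring X Quot J) (g d) D"
      if d: "d \<in> D" "w \<in> cone (fst d) (snd d)" for d
    proof
      have "J \<in> ?V i" if "i \<in> D" for i
        using D that additive_subgroup.zero_closed[of "?V i" "poly_ring X Quot J"]
        by (auto simp: stanley_decomposition_def finite_direct_sum_def)
      moreover have "?a \<in> ?V d"
        using d by (cases d) (auto simp: monomial_space_eq)
      ultimately show "g d \<in> Pi\<^sub>E D ?V"
        by (auto simp: g_def)
      have "finsum (poly_ring X Quot J) (g d) D
          = finsum (poly_ring X Quot J) (\<lambda>i. if d = i then ?a else zero (poly_ring X Quot J)) D"
        using ac zc by (intro Q.finsum_cong') (auto simp: g_def)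
      also have "\<dots> = ?a"
        using Q.finsum_singleton[OF d(1) fin, of "\<lambda>_. ?a"] ac by simp
      finally show "?a = finsum (poly_ring X Quot J) (g d) D" by simp
    qed
    have "g d = g e"
      using dec[OF ac] g[OF d] g[OF e] by blast
    then have "g d d = g e d" by simp
    then have "?a = J"
      using ne d by (simp add: g_def)
    then have "mon w \<in> J"
      using coset_eq_zero_iff[OF id wc] by simp
    then show False
      using w by (auto simp: J mem_monomial_ideal_iff[OF M])
  qed
  show ?thesis
    unfolding cone_partition_def using fin sub ex un by fast
qed

text \<open>Projection onto the span of the monomials in \<open>A\<close>: it extracts the component
  in a cone, and later the part of a polynomial free of given variables.\<close>

definition restrict_keys :: "'a set \<Rightarrow> ('a \<Rightarrow>\<^sub>0 'b::zero) \<Rightarrow> 'a \<Rightarrow>\<^sub>0 'b" where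
  "restrict_keys A = Poly_Mapping.mapp (\<lambda>w c. if w \<in> A then c else 0)"

lemma lookup_restrict_keys: "lookup (restrict_keys A p) w = (if w \<in> A then lookup p w else 0)"
  by (simp add: restrict_keys_def lookup_mapp when_def in_keys_iff)

lemma keys_restrict_keys: "keys (restrict_keys A p) = keys p \<inter> A"
  by (auto simp: in_keys_iff lookup_restrict_keys split: if_splits)

text \<open>Cutting a polynomial along the cones leaves a remainder supported on
  \<open>multiples M\<close>, hence in \<open>J\<close>. Two expansions of one class differ by an
  element of \<open>J\<close>, so their coefficients outside \<open>multiples M\<close> agree; each
  such coefficient belongs to a single cone.\<close>

lemma stanley_decomposition_of_cone_partition:
  fixes J :: "('x, 'k::field) mpoly set"
  assumes M: "M \<subseteq> monomials X" and J: "J = Idl\<^bsub>poly_ring X\<^esub> (mon ` M)"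
    and D: "cone_partition (monomials X - multiples M) D"
    and DX: "\<And>u Z. (u, Z) \<in> D \<Longrightarrow> u \<in> monomials X \<and> Z \<subseteq> X"
  shows "stanley_decomposition X J D"
proof -
  have id: "ideal J (poly_ring X)" unfolding J by (rule ideal_monomial_ideal[OF M])
  interpret R: cring "poly_ring X :: ('x, 'k) mpoly ring" by (rule cring_poly_ring)
  interpret Q: cring "poly_ring X Quot J"
    using id cring_poly_ring by (rule ideal.quotient_is_cring)
  interpret h: ring_hom_ring "poly_ring X" "poly_ring X Quot J" "(+>\<^bsub>poly_ring X\<^esub>) J"
    using id by (rule ideal.rcos_ring_hom_ring)
  let ?cls = "\<lambda>p. J +>\<^bsub>poly_ring X\<^esub> p"
  let ?V = "\<lambda>(u, Z). monomial_space X J u Z"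
  let ?C = "\<lambda>d. cone (fst d) (snd d)"
  have fin: "finite D" and sub: "\<And>d. d \<in> D \<Longrightarrow> ?C d \<subseteq> monomials X - multiples M"
    and part: "\<And>w. w \<in> monomials X - multiples M \<Longrightarrow> \<exists>!d. d \<in> D \<and> w \<in> ?C d"
    using D unfolding cone_partition_def by (simp_all add: case_prod_beta)
  have V: "?V d = ?cls ` {p. keys p \<subseteq> ?C d}" for d
    by (cases d) (simp add: monomial_space_eq)
  have cl: "p \<in> carrier (poly_ring X)" if "keys p \<subseteq> ?C d" "d \<in> D" for p :: "('x, 'k) mpoly" and d
    using that sub[OF that(2)] by (auto simp: carrier_poly_ring_iff monomials_def)
  have grp: "additive_subgroup (?V d) (poly_ring X Quot J)" if d: "d \<in> D" for d
  proof -
    let ?W = "{p :: ('x, 'k) mpoly. keys p \<subseteq> ?C d}"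
    have "subgroup ?W (add_monoid (poly_ring X :: ('x, 'k) mpoly ring))"
    proof (rule R.add.subgroupI)
      show "?W \<subseteq> carrier (poly_ring X)"
        using cl[OF _ d] by blast
      show "?W \<noteq> {}" by (auto intro: exI[of _ 0])
      show "\<ominus>\<^bsub>poly_ring X\<^esub> p \<in> ?W" if "p \<in> ?W" for p
        using that cl[of p d] d by simp
      show "p \<oplus>\<^bsub>poly_ring X\<^esub> q \<in> ?W"
        if "p \<in> ?W" "q \<in> ?W" for p q
        using that keys_add[of p q] by auto
    qed
    then show ?thesis
      unfolding V additive_subgroup_def by (rule h.img_is_add_subgroup)
  qed
  have dec: "\<exists>!f. f \<in> Pi\<^sub>E D ?V \<and> a = finsum (poly_ring X Quot J) f D"
    if a: "a \<in> carrier (poly_ring X Quot J)" for a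
  proof (rule ex_ex1I)
    obtain p where p: "p \<in> carrier (poly_ring X)" "a = ?cls p"
      using a by (auto simp: carrier_Quot)
    define q where "q d = restrict_keys (?C d) p" for d
    have kq: "keys (q d) \<subseteq> ?C d" for d
      by (simp add: q_def keys_restrict_keys)
    have qc: "q d \<in> carrier (poly_ring X)" if "d \<in> D" for d
      using cl[OF kq that] .
    have "p - sum q D \<in> J"
      unfolding J mem_monomial_ideal_iff[OF M]
    proof
      show c: "p - sum q D \<in> carrier (poly_ring X)"
        by (intro diff_poly_ring_closed p sum_poly_ring_closed fin qc)
      show "keys (p - sum q D) \<subseteq> multiples M"
      proof
        fix w assume w: "w \<in> keys (p - sum q D)"
        show "w \<in> multiples M"
        proof (rule ccontr)
          assume "w \<notin> multiples M"
          then have "w \<in> monomials X - multiples M"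
            using w c by (auto simp: carrier_poly_ring_iff monomials_def)
          then obtain d where d: "d \<in> D" "w \<in> ?C d" "\<And>e. e \<in> D \<Longrightarrow> w \<in> ?C e \<Longrightarrow> e = d"
            using part by metis
          have "w \<in> ?C e \<longleftrightarrow> e = d" if "e \<in> D" for e using d that by blast
          then have "lookup (sum q D) w = (\<Sum>e\<in>D. if e = d then lookup p w else 0)"
            unfolding lookup_sum by (intro sum.cong refl) (simp add: q_def lookup_restrict_keys)
          also have "\<dots> = lookup p w" using fin d(1) by simp
          finally show False using w by (simp add: in_keys_iff lookup_minus)
        qed
      qed
    qed
    then have "a = ?cls (sum q D)"
      using coset_eq_iff[OF id p(1) sum_poly_ring_closed[OF fin qc]] p by simp
    also have "\<dots> = finsum (poly_ring X Quot J) (\<lambda>d. ?cls (q d)) D"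
      by (rule finsum_Quot[OF id fin qc, symmetric])
    also have "\<dots> = finsum (poly_ring X Quot J) (\<lambda>d\<in>D. ?cls (q d)) D"
      using qc by (intro Q.finsum_cong') auto
    finally have "a = finsum (poly_ring X Quot J) (\<lambda>d\<in>D. ?cls (q d)) D" .
    moreover have "(\<lambda>d\<in>D. ?cls (q d)) \<in> Pi\<^sub>E D ?V"
      using kq unfolding V by auto
    ultimately show "\<exists>f. f \<in> Pi\<^sub>E D ?V \<and> a = finsum (poly_ring X Quot J) f D" by blast
  next
    fix f g
    assume f: "f \<in> Pi\<^sub>E D ?V \<and> a = finsum (poly_ring X Quot J) f D"
      and g: "g \<in> Pi\<^sub>E D ?V \<and> a = finsum (poly_ring X Quot J) g D"
    have rep: "\<exists>p. (\<forall>d\<in>D. keys (p d) \<subseteq> ?C d \<and> f d = ?cls (p d)) \<and> a = ?cls (sum p D)"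
      if f: "f \<in> Pi\<^sub>E D ?V \<and> a = finsum (poly_ring X Quot J) f D" for f
    proof -
      have "\<forall>d\<in>D. \<exists>p. keys p \<subseteq> ?C d \<and> f d = ?cls p"
        using f unfolding V by (auto dest!: PiE_mem)
      then obtain p where p: "\<forall>d\<in>D. keys (p d) \<subseteq> ?C d \<and> f d = ?cls (p d)"
        by metis
      have pc: "p d \<in> carrier (poly_ring X)" if "d \<in> D" for d
        using p cl that by blast
      have "finsum (poly_ring X Quot J) f D = finsum (poly_ring X Quot J) (\<lambda>d. ?cls (p d)) D"
        using p pc by (intro Q.finsum_cong') auto
      also have "\<dots> = ?cls (sum p D)"
        by (rule finsum_Quot[OF id fin pc])
      finally show ?thesis using p f by auto
    qed
    obtain p where p: "\<forall>d\<in>D. keys (p d) \<subseteq> ?C d \<and> f d = ?cls (p d)" "a = ?cls (sum p D)"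
      using rep[OF f] by blast
    obtain q where q: "\<forall>d\<in>D. keys (q d) \<subseteq> ?C d \<and> g d = ?cls (q d)" "a = ?cls (sum q D)"
      using rep[OF g] by blast
    have pc: "p d \<in> carrier (poly_ring X)" and qc: "q d \<in> carrier (poly_ring X)" if "d \<in> D" for d
      using p q cl that by blast+
    have "sum p D - sum q D \<in> J"
      using p(2) q(2) coset_eq_iff[OF id sum_poly_ring_closed[OF fin] sum_poly_ring_closed[OF fin]] pc qc
      by metis
    then have diff: "keys (sum p D - sum q D) \<subseteq> multiples M"
      by (simp add: J mem_monomial_ideal_iff[OF M])
    have "p d = q d" if d: "d \<in> D" for d
    proof (rule poly_mapping_eqI)
      fix w
      show "lookup (p d) w = lookup (q d) w"
      proof (cases "w \<in> ?C d")
        case False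
        then show ?thesis using p q d by (metis in_keys_iff subsetD)
      next
        case True
        have w: "w \<in> monomials X - multiples M" using sub[OF d] True by blast
        have uniq: "e = d" if "e \<in> D" "w \<in> ?C e" for e
          using part[OF w] that d True by blast
        have single: "lookup (sum r D) w = lookup (r d) w"
          if r: "\<forall>d\<in>D. keys (r d) \<subseteq> ?C d" for r :: "_ \<Rightarrow> ('x, 'k) mpoly"
        proof -
          have "lookup (sum r D) w = (\<Sum>e\<in>D. if e = d then lookup (r d) w else 0)"
            unfolding lookup_sum by (intro sum.cong refl) (use uniq r in \<open>force simp: in_keys_iff subset_iff\<close>)
          also have "\<dots> = lookup (r d) w" using fin d by simp
          finally show ?thesis .
        qed
        have "w \<notin> keys (sum p D - sum q D)" using diff w by blast
        then show ?thesis
          using single[of p] single[of q] p(1) q(1) by (simp add: in_keys_iff lookup_minus)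
      qed
    qed
    then have "f d = g d" if "d \<in> D" for d
      using p(1) q(1) that by metis
    then show "f = g"
      using f g by (meson PiE_ext)
  qed
  have "is_stanley_space X J u Z" if "(u, Z) \<in> D" for u Z
    using is_stanley_space_iff[OF M J] DX[OF that] sub[OF that] by auto
  then have "\<forall>(u, Z)\<in>D. is_stanley_space X J u Z" by blast
  moreover have "finite_direct_sum (poly_ring X Quot J) D ?V"
    unfolding finite_direct_sum_def by (intro conjI fin ballI grp dec)
  ultimately show ?thesis
    unfolding stanley_decomposition_def by (rule conjI)
qed

section \<open>Depth is bounded by the dimension of the largest face\<close>

fun power_prod :: "'a::comm_monoid_mult list \<Rightarrow> nat list \<Rightarrow> 'a" where
  "power_prod (f # fs) (a # as) = f ^ a * power_prod fs as"
| "power_prod _ _ = 1"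

definition exponents :: "nat \<Rightarrow> nat \<Rightarrow> nat list set" where
  "exponents k t = {as. set as \<subseteq> {..<t} \<and> length as = k}"

text \<open>The value at \<open>fs\<close> of the polynomial with coefficients \<open>c\<close>.
  Each exponent is separately below \<open>t\<close>, which gives \<open>t ^ k\<close> terms for
  \<open>k\<close> variables.\<close>

definition poly_at :: "(nat list \<Rightarrow> 'k) \<Rightarrow> nat \<Rightarrow> ('x, 'k::field) mpoly list \<Rightarrow> ('x, 'k) mpoly" where
  "poly_at c t fs = (\<Sum>as\<in>exponents (length fs) t. Poly_Mapping.single 0 (c as) * power_prod fs as)"

lemma exponents_Suc: "exponents (Suc k) t = (\<lambda>(i, as). i # as) ` ({..<t} \<times> exponents k t)"
  by (auto simp: exponents_def length_Suc_conv image_iff)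

lemma finite_exponents [simp]: "finite (exponents k t)"
  unfolding exponents_def by (rule finite_lists_length_eq) simp

lemma card_exponents: "card (exponents k t) = t ^ k"
  unfolding exponents_def by (subst card_lists_length_eq) simp_all

lemma poly_at_Nil: "poly_at c t [] = Poly_Mapping.single 0 (c [])"
proof -
  have "exponents 0 t = {[]}" by (auto simp: exponents_def)
  then show ?thesis by (simp add: poly_at_def)
qed

text \<open>Terms are collected by the exponent of \<open>f\<close>, which sets up induction along
  the sequence.\<close>

lemma poly_at_Cons: "poly_at c t (f # fs) = (\<Sum>i<t. f ^ i * poly_at (\<lambda>as. c (i # as)) t fs)"
proof -
  have inj: "inj_on (\<lambda>(i, as). i # as) ({..<t} \<times> exponents (length fs) t)"
    by (auto simp: inj_on_def)
  have "poly_at c t (f # fs) = (\<Sum>(i, as)\<in>{..<t} \<times> exponents (length fs) t.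
      Poly_Mapping.single 0 (c (i # as)) * (f ^ i * power_prod fs as))"
    by (simp only: poly_at_def length_Cons exponents_Suc sum.reindex[OF inj] o_def)
      (simp add: case_prod_beta')
  then show ?thesis
    by (simp add: poly_at_def sum.cartesian_product[symmetric] sum_distrib_left mult.left_commute)
qed

lemma power_poly_ring_closed:
  fixes p :: "('x, 'k::field) mpoly"
  assumes "p \<in> carrier (poly_ring X)"
  shows "p ^ a \<in> carrier (poly_ring X)"
proof (induction a)
  case 0
  show ?case by (simp add: carrier_poly_ring_iff)
next
  case (Suc a)
  then show ?case using mult_poly_ring_closed[OF assms] by simp
qed

lemma power_prod_closed:
  fixes fs :: "('x, 'k::field) mpoly list"
  assumes "set fs \<subseteq> carrier (poly_ring X)"
  shows "power_prod fs as \<in> carrier (poly_ring X)"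
proof -
  have one: "1 \<in> carrier (poly_ring X :: ('x, 'k) mpoly ring)"
    by (simp add: carrier_poly_ring_iff)
  show ?thesis
    using assms
    by (induction fs as rule: power_prod.induct)
      (auto intro: mult_poly_ring_closed power_poly_ring_closed one)
qed

lemma const_closed: "Poly_Mapping.single 0 c \<in> carrier (poly_ring X)"
  by (simp add: carrier_poly_ring_iff)

lemma poly_at_closed:
  assumes "set fs \<subseteq> carrier (poly_ring X)"
  shows "poly_at c t fs \<in> carrier (poly_ring X)"
  unfolding poly_at_def
  by (intro sum_poly_ring_closed mult_poly_ring_closed const_closed power_prod_closed assms) simp

lemma regular_sequence_Cons:
  assumes "regular_sequence R J (f # fs)"
  shows "regular_sequence R (insert f J) fs"
proof -
  have "Idl\<^bsub>R\<^esub> (J \<union> set (take (Suc i) (f # fs))) = Idl\<^bsub>R\<^esub> (insert f J \<union> set (take i fs))" for i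
    by simp
  then show ?thesis
    using assms unfolding regular_sequence_def by fastforce
qed

text \<open>If the polynomial has a nonzero coefficient, a power of the first variable can be split off until
  it is nonzero modulo that variable; regularity of the first element cancels the power in \<open>R/J\<close>.\<close>
lemma regular_sequence_algebraically_independent:
  fixes fs :: "('x, 'k::field) mpoly list"
  assumes "regular_sequence (poly_ring X) J fs" "J \<subseteq> carrier (poly_ring X)"
    and "poly_at c t fs \<in> Idl\<^bsub>poly_ring X\<^esub> J" "as \<in> exponents (length fs) t"
  shows "c as = 0"
  using assms
proof (induction fs arbitrary: J c as)
  case Nil
  interpret R: cring "poly_ring X :: ('x, 'k) mpoly ring" by (rule cring_poly_ring)
  interpret I: ideal "Idl\<^bsub>poly_ring X\<^esub> J" "poly_ring X"
    using Nil.prems(2) by (rule R.genideal_ideal)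
  show ?case
  proof (rule ccontr)
    assume ne: "c as \<noteq> 0"
    have as: "as = []" using Nil.prems(4) by (simp add: exponents_def)
    \<comment> \<open>A nonzero constant in the ideal is a unit, against the properness clause of
      regularity.\<close>
    have "Poly_Mapping.single 0 (inverse (c [])) * Poly_Mapping.single 0 (c []) \<in> Idl\<^bsub>poly_ring X\<^esub> J"
      using I.I_l_closed[OF Nil.prems(3) const_closed] by (simp add: poly_at_Nil)
    then have "1 \<in> Idl\<^bsub>poly_ring X\<^esub> J"
      using ne by (simp add: mult_single as)
    then have "Idl\<^bsub>poly_ring X\<^esub> J = carrier (poly_ring X)"
      using I.one_imp_carrier by simp
    then show False using Nil.prems(1) by (simp add: regular_sequence_def)
  qed
next
  case (Cons f fs)
  interpret R: cring "poly_ring X :: ('x, 'k) mpoly ring" by (rule cring_poly_ring)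
  have fc: "f \<in> carrier (poly_ring X)" and fsc: "set fs \<subseteq> carrier (poly_ring X)"
    using Cons.prems(1) by (auto simp: regular_sequence_def)
  have J': "insert f J \<subseteq> carrier (poly_ring X)" using fc Cons.prems(2) by auto
  interpret I: ideal "Idl\<^bsub>poly_ring X\<^esub> J" "poly_ring X"
    using Cons.prems(2) by (rule R.genideal_ideal)
  interpret I': ideal "Idl\<^bsub>poly_ring X\<^esub> (insert f J)" "poly_ring X"
    using J' by (rule R.genideal_ideal)
  have reg: "a \<in> Idl\<^bsub>poly_ring X\<^esub> J"
    if "f * a \<in> Idl\<^bsub>poly_ring X\<^esub> J" "a \<in> carrier (poly_ring X)" for a
    using Cons.prems(1) that unfolding regular_sequence_def by (auto dest: spec[of _ 0])
  have reg_pow: "a \<in> Idl\<^bsub>poly_ring X\<^esub> J"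
    if "f ^ i * a \<in> Idl\<^bsub>poly_ring X\<^esub> J" "a \<in> carrier (poly_ring X)" for i a
    using that
  proof (induction i)
    case (Suc i)
    have "f ^ i * a \<in> carrier (poly_ring X)"
      using fc Suc.prems(2) by (intro mult_poly_ring_closed power_poly_ring_closed)
    then have "f ^ i * a \<in> Idl\<^bsub>poly_ring X\<^esub> J"
      using Suc.prems(1) by (intro reg[of "f ^ i * a"]) (simp_all add: mult.assoc)
    then show ?case using Suc by blast
  qed simp
  let ?E = "\<lambda>i. poly_at (\<lambda>as. c (i # as)) t fs"
  have Ec: "?E i \<in> carrier (poly_ring X)" for i by (rule poly_at_closed[OF fsc])
  \<comment> \<open>Coefficients are shown to vanish in the order of the power of \<open>f\<close>,
    lowest first.\<close>
  have "\<forall>as\<in>exponents (length fs) t. c (i # as) = 0" if "i < t" for i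
    using that
  proof (induction i rule: less_induct)
    case (less i)
    have E0: "?E j = 0" if "j < i" for j
      unfolding poly_at_def by (rule sum.neutral) (use less.IH[of j] less.prems that in auto)
    \<comment> \<open>All terms beyond the power \<open>i\<close> have a factor
      \<open>f ^ Suc i\<close>, and \<open>a\<close> is the cofactor; once the lower terms vanish
      the polynomial is \<open>f ^ i * (?E i + f * a)\<close>.\<close>
    define a where "a = (\<Sum>j\<in>{Suc i..<t}. f ^ (j - Suc i) * ?E j)"
    have ac: "a \<in> carrier (poly_ring X)"
      unfolding a_def
      by (intro sum_poly_ring_closed mult_poly_ring_closed power_poly_ring_closed fc Ec) simp
    have "poly_at c t (f # fs) = (\<Sum>j\<in>{..<t}. f ^ j * ?E j)"
      by (rule poly_at_Cons)
    also have "\<dots> = (\<Sum>j\<in>{i..<t}. f ^ j * ?E j)"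
      by (rule sum.mono_neutral_right) (use E0 in auto)
    also have "\<dots> = f ^ i * ?E i + (\<Sum>j\<in>{Suc i..<t}. f ^ j * ?E j)"
      using less.prems by (subst sum.atLeast_Suc_lessThan) auto
    also have "(\<Sum>j\<in>{Suc i..<t}. f ^ j * ?E j) = f ^ i * (f * a)"
      unfolding a_def sum_distrib_left
    proof (rule sum.cong)
      fix j assume "j \<in> {Suc i..<t}"
      then have "f ^ j = f ^ i * (f * f ^ (j - Suc i))"
        by (simp flip: power_Suc power_add)
      then show "f ^ j * ?E j = f ^ i * (f * (f ^ (j - Suc i) * ?E j))"
        by (simp add: mult.assoc)
    qed simp
    finally have "poly_at c t (f # fs) = f ^ i * (?E i + f * a)"
      by (simp add: distrib_left)
    moreover have sc: "?E i + f * a \<in> carrier (poly_ring X)"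
      using R.a_closed[OF Ec[of i] mult_poly_ring_closed[OF fc ac]] by simp
    \<comment> \<open>Regularity cancels \<open>f ^ i\<close>. Modulo \<open>f\<close> only
      \<open>?E i\<close> survives, to which the induction hypothesis over \<open>insert f J\<close>
      applies.\<close>
    ultimately have "?E i + f * a \<in> Idl\<^bsub>poly_ring X\<^esub> J"
      using Cons.prems(3) reg_pow by simp
    moreover have "Idl\<^bsub>poly_ring X\<^esub> J \<subseteq> Idl\<^bsub>poly_ring X\<^esub> (insert f J)"
      using R.subset_Idl_subset[OF J', of J] by blast
    ultimately have 1: "?E i + f * a \<in> Idl\<^bsub>poly_ring X\<^esub> (insert f J)" by blast
    have "f \<in> Idl\<^bsub>poly_ring X\<^esub> (insert f J)"
      using R.genideal_self[OF J'] by blast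
    then have 2: "f * a \<in> Idl\<^bsub>poly_ring X\<^esub> (insert f J)"
      using I'.I_r_closed[OF _ ac] by simp
    have "(?E i + f * a) + - (f * a) \<in> Idl\<^bsub>poly_ring X\<^esub> (insert f J)"
      using I'.a_closed[OF 1 I'.a_inv_closed[OF 2]] a_inv_poly_ring[OF mult_poly_ring_closed[OF fc ac]] by simp
    then have "?E i \<in> Idl\<^bsub>poly_ring X\<^esub> (insert f J)" by simp
    then show ?case
      using Cons.IH[OF regular_sequence_Cons[OF Cons.prems(1)] J'] by blast
  qed
  then show ?case
    using Cons.prems(4) by (auto simp: exponents_Suc)
qed

text \<open>Gaussian elimination for a homogeneous system with unknowns indexed by \<open>A\<close>
  and fewer equations, indexed by \<open>S\<close>: an equation is either trivial or used to
  eliminate one unknown.\<close>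

lemma ex_nontrivial_relation:
  fixes c :: "'a \<Rightarrow> 'b \<Rightarrow> 'k::field"
  assumes "finite S" "finite A" "card S < card A"
  shows "\<exists>x. (\<exists>a\<in>A. x a \<noteq> 0) \<and> (\<forall>s\<in>S. (\<Sum>a\<in>A. x a * c a s) = 0)"
  using assms
proof (induction S arbitrary: A c)
  case empty
  then have "A \<noteq> {}" by auto
  then show ?case by (intro exI[of _ "\<lambda>_. 1"]) auto
next
  case (insert s S)
  show ?case
  proof (cases "\<forall>a\<in>A. c a s = 0")
    case True
    have "card S < card A" using insert by simp
    then obtain x where "\<exists>a\<in>A. x a \<noteq> 0" "\<forall>s\<in>S. (\<Sum>a\<in>A. x a * c a s) = 0"
      using insert.IH[OF insert.prems(1), of c] by auto
    then show ?thesis using True by (intro exI[of _ x]) auto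
  next
    case False
    then obtain b where b: "b \<in> A" "c b s \<noteq> 0" by auto
    let ?A = "A - {b}"
    have "card S < card ?A" using insert b by simp
    then obtain x where x: "\<exists>a\<in>?A. x a \<noteq> 0"
      "\<forall>r\<in>S. (\<Sum>a\<in>?A. x a * (c a r - c a s / c b s * c b r)) = 0"
      using insert.IH[of ?A "\<lambda>a r. c a r - c a s / c b s * c b r"] insert.prems(1) by auto
    \<comment> \<open>Equation \<open>s\<close> is solved for the pivot unknown
      \<open>b\<close>.\<close>
    define y where "y = x(b := - (\<Sum>a\<in>?A. x a * c a s) / c b s)"
    have sum_y: "(\<Sum>a\<in>A. y a * c a r) = y b * c b r + (\<Sum>a\<in>?A. x a * c a r)" for r
      using b insert.prems(1) by (subst sum.remove[of A b]) (auto simp: y_def intro: sum.cong)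
    have "(\<Sum>a\<in>A. y a * c a r) = 0" if "r \<in> insert s S" for r
    proof (cases "r = s")
      case True
      then show ?thesis using b unfolding sum_y by (simp add: y_def)
    next
      case False
      then have "(\<Sum>a\<in>?A. x a * c a r) = (\<Sum>a\<in>?A. x a * c a s / c b s * c b r)"
        using x(2) that by (simp add: right_diff_distrib sum_subtractf mult.assoc)
      then show ?thesis unfolding sum_y
        by (simp add: y_def sum_divide_distrib sum_distrib_right)
    qed
    moreover have "\<exists>a\<in>A. y a \<noteq> 0" using x(1) by (auto simp: y_def)
    ultimately show ?thesis by blast
  qed
qed

section \<open>Counting monomials with bounded exponents\<close>

definition exp_bounded :: "nat \<Rightarrow> ('x, 'k::field) mpoly \<Rightarrow> bool" where
  "exp_bounded N p \<longleftrightarrow> (\<forall>u\<in>keys p. \<forall>x. lookup u x \<le> N)"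

lemma exp_bounded_mult:
  assumes "exp_bounded M p" "exp_bounded N q"
  shows "exp_bounded (M + N) (p * q)"
  unfolding exp_bounded_def
proof (intro ballI allI)
  fix w x assume "w \<in> keys (p * q)"
  then obtain u v where "u \<in> keys p" "v \<in> keys q" "w = u + v"
    using keys_mult[of p q] by blast
  then show "lookup w x \<le> M + N"
    using assms by (auto simp: exp_bounded_def lookup_add intro: add_mono)
qed

lemma exp_bounded_mono: "exp_bounded M p \<Longrightarrow> M \<le> N \<Longrightarrow> exp_bounded N p"
  unfolding exp_bounded_def using le_trans by blast

lemma exp_bounded_one: "exp_bounded N 1"
  by (simp add: exp_bounded_def)

lemma exp_bounded_power: "exp_bounded N p \<Longrightarrow> exp_bounded (a * N) (p ^ a)"
  by (induction a) (auto intro: exp_bounded_mult exp_bounded_one)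

lemma exp_bounded_power_prod:
  assumes "\<forall>f\<in>set fs. exp_bounded B f" "as \<in> exponents (length fs) t"
  shows "exp_bounded (length fs * (t * B)) (power_prod fs as)"
  using assms
proof (induction fs arbitrary: as)
  case (Cons f fs)
  then obtain i bs where as: "as = i # bs" "i < t" "bs \<in> exponents (length fs) t"
    by (auto simp: exponents_Suc)
  have "exp_bounded (t * B) (f ^ i)"
    using Cons.prems as by (intro exp_bounded_mono[OF exp_bounded_power[of B f i]]) auto
  then show ?case
    using Cons as exp_bounded_mult[of "t * B" "f ^ i" "length fs * (t * B)" "power_prod fs bs"]
    by (simp add: algebra_simps)
qed (simp add: exponents_def exp_bounded_one)

lemma ex_exp_bounded:
  assumes "finite S"
  shows "\<exists>B. \<forall>f\<in>S. exp_bounded B f"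
proof -
  let ?E = "\<Union>f\<in>S. \<Union>u\<in>keys f. lookup u ` keys u"
  have fin: "finite ?E" using assms by auto
  have "exp_bounded (Max (insert 0 ?E)) f" if "f \<in> S" for f
    unfolding exp_bounded_def
  proof (intro ballI allI)
    fix u x assume u: "u \<in> keys f"
    show "lookup u x \<le> Max (insert 0 ?E)"
    proof (cases "x \<in> keys u")
      case True
      then have "lookup u x \<in> ?E" using u that by blast
      then show ?thesis using fin by (intro Max_ge) auto
    qed (simp add: in_keys_iff)
  qed
  then show ?thesis by blast
qed

text \<open>Exponent vectors vanish off \<open>F\<close>, so restriction to \<open>F\<close> embeds
  them into the functions from \<open>F\<close> to \<open>{..N}\<close>.\<close>

lemma card_bounded_monomials:
  assumes "finite F"
  shows "finite {u :: 'x \<Rightarrow>\<^sub>0 nat. keys u \<subseteq> F \<and> (\<forall>x. lookup u x \<le> N)}"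
    and "card {u :: 'x \<Rightarrow>\<^sub>0 nat. keys u \<subseteq> F \<and> (\<forall>x. lookup u x \<le> N)} \<le> (N + 1) ^ card F"
proof -
  let ?A = "{u :: 'x \<Rightarrow>\<^sub>0 nat. keys u \<subseteq> F \<and> (\<forall>x. lookup u x \<le> N)}"
  let ?r = "\<lambda>u. restrict (lookup u) F"
  have inj: "inj_on ?r ?A"
  proof (rule inj_onI)
    fix u v assume uv: "u \<in> ?A" "v \<in> ?A" "?r u = ?r v"
    show "u = v"
    proof (rule poly_mapping_eqI)
      fix x show "lookup u x = lookup v x"
        using uv(1,2) fun_cong[OF uv(3), of x]
        by (cases "x \<in> F") (simp, metis (mono_tags, lifting) in_keys_iff mem_Collect_eq subsetD)
    qed
  qed
  have sub: "?r ` ?A \<subseteq> F \<rightarrow>\<^sub>E {..N}" by auto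
  have fin: "finite (F \<rightarrow>\<^sub>E {..N})" using assms by (intro finite_PiE) auto
  show "finite ?A" using inj sub fin by (meson finite_imageD finite_subset)
  have "card ?A = card (?r ` ?A)" using inj by (simp add: card_image)
  also have "\<dots> \<le> card (F \<rightarrow>\<^sub>E {..N})" using sub fin by (rule card_mono[rotated])
  also have "\<dots> = (N + 1) ^ card F" using assms by (simp add: card_PiE)
  finally show "card ?A \<le> (N + 1) ^ card F" .
qed

text \<open>A regular sequence of length \<open>k\<close> would give \<open>t ^ k\<close> linearly independent elements of \<open>R/J\<close>
  with exponents \<open>O(t)\<close>, while there are only \<open>O(t ^ d)\<close> monomials of that size outside \<open>J\<close>.\<close>
lemma regular_sequence_length_le:
  fixes fs :: "('x, 'k::field) mpoly list"
  assumes X: "finite X" and M: "M \<subseteq> monomials X" and J: "J = Idl\<^bsub>poly_ring X\<^esub> (mon ` M)"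
    and squarefree: "\<And>m x. m \<in> M \<Longrightarrow> lookup m x \<le> 1"
    and faces: "\<And>F. F \<subseteq> X \<Longrightarrow> (\<And>m. m \<in> M \<Longrightarrow> \<not> keys m \<subseteq> F) \<Longrightarrow> card F \<le> d"
    and reg: "regular_sequence (poly_ring X) J fs"
  shows "length fs \<le> d"
proof (rule ccontr)
  interpret R: cring "poly_ring X :: ('x, 'k) mpoly ring" by (rule cring_poly_ring)
  have id: "ideal J (poly_ring X)" unfolding J by (rule ideal_monomial_ideal[OF M])
  have JJ: "Idl\<^bsub>poly_ring X\<^esub> J = J"
    using R.genideal_minimal[OF id] R.genideal_self[of J] id
    by (metis additive_subgroup.a_subset ideal.axioms(1) subset_antisym subset_refl)
  have fsc: "set fs \<subseteq> carrier (poly_ring X)" using reg by (simp add: regular_sequence_def)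
  assume "\<not> length fs \<le> d"
  then have k: "Suc d \<le> length fs" by simp
  obtain B where B: "\<forall>f\<in>set fs. exp_bounded B f"
    using ex_exp_bounded[of "set fs"] by auto
  \<comment> \<open>\<open>C * t ^ d\<close> will bound \<open>card S\<close>: there are at most
    \<open>2 ^ card X\<close> faces, each with at most \<open>(N + 1) ^ d\<close> monomials, and
    \<open>N + 1 \<le> (length fs * B + 1) * t\<close>. Taking \<open>t\<close> above
    \<open>C\<close> makes the bound smaller than \<open>t ^ Suc d\<close>.\<close>
  define C where "C = 2 ^ card X * (length fs * B + 1) ^ d"
  define t where "t = Suc C"
  define N where "N = length fs * (t * B)"
  let ?S = "\<lambda>F. {u :: 'x \<Rightarrow>\<^sub>0 nat. keys u \<subseteq> F \<and> (\<forall>x. lookup u x \<le> N)}"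
  define S where "S = ?S X - multiples M"
  let ?Fs = "{F. F \<subseteq> X \<and> (\<forall>m\<in>M. \<not> keys m \<subseteq> F)}"
  have finS: "finite S"
    unfolding S_def using card_bounded_monomials(1)[OF X] by blast
  have finF: "finite ?Fs" "card ?Fs \<le> 2 ^ card X"
    using X card_mono[of "Pow X" ?Fs] by (auto simp: card_Pow)
  \<comment> \<open>As the generators are squarefree, the support of a monomial outside the ideal
    contains the support of no generator, so it is a face.\<close>
  have "S \<subseteq> (\<Union>F\<in>?Fs. ?S F)"
  proof
    fix u assume u: "u \<in> S"
    have "\<not> keys m \<subseteq> keys u" if m: "m \<in> M" for m
    proof
      assume "keys m \<subseteq> keys u"
      have "lookup m x \<le> lookup u x" for x
      proof (cases "x \<in> keys m")
        case True
        then have "x \<in> keys u" using \<open>keys m \<subseteq> keys u\<close> by blast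
        then have "lookup u x \<noteq> 0" by (simp add: in_keys_iff)
        then show ?thesis using squarefree[OF m, of x] by simp
      qed (simp add: in_keys_iff)
      then show False using u m by (auto simp: S_def multiples_def monomial_dvd_def)
    qed
    then show "u \<in> (\<Union>F\<in>?Fs. ?S F)" using u by (auto simp: S_def)
  qed
  then have "card S \<le> card (\<Union>F\<in>?Fs. ?S F)"
    using finF X by (intro card_mono finite_UN_I card_bounded_monomials(1)) (auto intro: finite_subset)
  also have "\<dots> \<le> (\<Sum>F\<in>?Fs. card (?S F))"
    by (rule card_UN_le[OF finF(1)])
  also have "\<dots> \<le> (\<Sum>F\<in>?Fs. (N + 1) ^ d)"
  proof (rule sum_mono)
    fix F assume F: "F \<in> ?Fs"
    then have "card (?S F) \<le> (N + 1) ^ card F"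
      using X by (intro card_bounded_monomials(2)) (auto intro: finite_subset)
    also have "\<dots> \<le> (N + 1) ^ d"
      using F faces[of F] by (intro power_increasing) auto
    finally show "card (?S F) \<le> (N + 1) ^ d" .
  qed
  also have "\<dots> = card ?Fs * (N + 1) ^ d" by simp
  also have "\<dots> \<le> 2 ^ card X * ((length fs * B + 1) * t) ^ d"
    using finF(2) by (intro mult_mono power_mono) (auto simp: N_def t_def algebra_simps)
  also have "\<dots> = C * t ^ d" by (simp only: C_def power_mult_distrib mult.assoc)
  also have "\<dots> < t * t ^ d" by (simp add: t_def)
  also have "\<dots> \<le> t ^ length fs"
    using k power_increasing[OF k, of t] by (simp add: t_def)
  finally have "card S < card (exponents (length fs) t)" by (simp add: card_exponents)
  then obtain c where c: "\<exists>as\<in>exponents (length fs) t. c as \<noteq> 0"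
    "\<forall>w\<in>S. (\<Sum>as\<in>exponents (length fs) t. c as * lookup (power_prod fs as) w) = 0"
    using ex_nontrivial_relation[OF finS finite_exponents, where c = "\<lambda>as. lookup (power_prod fs as)"] by blast
  have lookup_const: "lookup (Poly_Mapping.single 0 a * p) w = a * lookup p w" for a w and p :: "('x, 'k) mpoly"
    by (simp flip: mult_map_scale_conv_mult add: map.rep_eq when_def)
  have look: "lookup (poly_at c t fs) w = (\<Sum>as\<in>exponents (length fs) t. c as * lookup (power_prod fs as) w)" for w
    by (simp add: poly_at_def lookup_sum lookup_const)
  \<comment> \<open>Every exponent that occurs is at most \<open>N\<close>, so a monomial outside
    \<open>multiples M\<close> would lie in \<open>S\<close>, where the coefficient was made to
    vanish.\<close>
  have "poly_at c t fs \<in> J"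
    unfolding J mem_monomial_ideal_iff[OF M]
  proof
    show pc: "poly_at c t fs \<in> carrier (poly_ring X)" by (rule poly_at_closed[OF fsc])
    show "keys (poly_at c t fs) \<subseteq> multiples M"
    proof
      fix w assume w: "w \<in> keys (poly_at c t fs)"
      then have ne: "(\<Sum>as\<in>exponents (length fs) t. c as * lookup (power_prod fs as) w) \<noteq> 0"
        by (simp add: in_keys_iff look)
      then obtain as where as: "as \<in> exponents (length fs) t" "lookup (power_prod fs as) w \<noteq> 0"
        by (metis (mono_tags, lifting) mult_zero_right sum.neutral)
      then have "\<forall>x. lookup w x \<le> N"
        using exp_bounded_power_prod[OF B as(1)] by (auto simp: exp_bounded_def N_def in_keys_iff)
      then have "w \<in> ?S X" using w pc by (auto simp: carrier_poly_ring_iff)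
      moreover have "w \<notin> S" using c(2) ne by blast
      ultimately show "w \<in> multiples M" by (auto simp: S_def)
    qed
  qed
  then have "poly_at c t fs \<in> Idl\<^bsub>poly_ring X\<^esub> J" by (simp add: JJ)
  moreover have "J \<subseteq> carrier (poly_ring X)"
    using id by (simp add: additive_subgroup.a_subset ideal.axioms(1))
  ultimately show False
    using regular_sequence_algebraically_independent[OF reg] c(1) by blast
qed

text \<open>Properness of \<open>J\<close> excludes the value \<open>\<infinity>\<close>; the bound
  on lengths then passes to the supremum.\<close>

lemma depth_quot_le:
  fixes J :: "('x, 'k::field) mpoly set"
  assumes "finite X" "M \<subseteq> monomials X" and "J = Idl\<^bsub>poly_ring X\<^esub> (mon ` M)"
    and "\<And>m x. m \<in> M \<Longrightarrow> lookup m x \<le> 1"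
    and "\<And>F. F \<subseteq> X \<Longrightarrow> (\<And>m. m \<in> M \<Longrightarrow> \<not> keys m \<subseteq> F) \<Longrightarrow> card F \<le> d"
    and "J \<noteq> carrier (poly_ring X)"
  shows "depth_quot X J \<le> enat d"
proof -
  have "length fs \<le> d" if "regular_sequence (poly_ring X) J fs" for fs
    using assms(1-5) that by (rule regular_sequence_length_le)
  then show ?thesis
    unfolding depth_quot_def using assms(6) by (auto intro!: Sup_least)
qed

section \<open>Krull dimension is at least the dimension of a face\<close>

lemma (in cring) Quot_image_mem_iff:
  assumes "ideal I R" "ideal P R" "I \<subseteq> P" "a \<in> carrier R"
  shows "I +> a \<in> (+>) I ` P \<longleftrightarrow> a \<in> P"
proof
  interpret I: ideal I R by fact
  interpret P: ideal P R by fact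
  assume "I +> a \<in> (+>) I ` P"
  then obtain p where p: "p \<in> P" "I +> a = I +> p" by blast
  then have "a \<in> I +> p" using I.a_rcos_self[OF assms(4)] by simp
  then obtain i where "i \<in> I" "a = i \<oplus> p" by (auto simp: a_r_coset_def')
  then show "a \<in> P" using assms(3) p(1) by auto
qed auto

text \<open>Since \<open>P\<close> contains \<open>I\<close>, membership in its image can be tested
  on any representative, so primality descends.\<close>

lemma (in cring) primeideal_Quot:
  assumes I: "ideal I R" and P: "primeideal P R" and IP: "I \<subseteq> P"
  shows "primeideal ((+>) I ` P) (R Quot I)"
proof (rule primeidealI)
  interpret P: primeideal P R by fact
  interpret I: ideal I R by fact
  have mem: "I +> a \<in> (+>) I ` P \<longleftrightarrow> a \<in> P" if "a \<in> carrier R" for a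
    by (rule Quot_image_mem_iff[OF I P.is_ideal IP that])
  show "ideal ((+>) I ` P) (R Quot I)"
    by (rule ring_ideal_imp_quot_ideal[OF I P.is_ideal])
  show "cring (R Quot I)"
    by (rule I.quotient_is_cring[OF is_cring])
  show "carrier (R Quot I) \<noteq> (+>) I ` P"
  proof
    assume "carrier (R Quot I) = (+>) I ` P"
    then have "a \<in> P" if "a \<in> carrier R" for a
      using mem[OF that] that unfolding carrier_Quot by blast
    then show False using P.I_notcarr P.a_subset by blast
  qed
  fix x y assume "x \<in> carrier (R Quot I)" "y \<in> carrier (R Quot I)"
    and xy: "x \<otimes>\<^bsub>R Quot I\<^esub> y \<in> (+>) I ` P"
  then obtain a b where ab: "a \<in> carrier R" "b \<in> carrier R" "x = I +> a" "y = I +> b"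
    by (auto simp: carrier_Quot)
  then have "I +> (a \<otimes> b) \<in> (+>) I ` P"
    using xy I.rcoset_mult_add by (simp add: FactRing_def)
  then have "a \<otimes> b \<in> P" using mem ab by simp
  then show "x \<in> (+>) I ` P \<or> y \<in> (+>) I ` P"
    using P.I_prime ab by blast
qed

section \<open>Primes generated by variables, and chains of them\<close>

definition variables :: "'x set \<Rightarrow> ('x \<Rightarrow>\<^sub>0 nat) set" where
  "variables Y = (\<lambda>y. Poly_Mapping.single y 1) ` Y"

lemma variables_subset: "Y \<subseteq> X \<Longrightarrow> variables Y \<subseteq> monomials X"
  by (auto simp: variables_def monomials_def)

lemma multiples_variables: "multiples (variables Y) = {w. keys w \<inter> Y \<noteq> {}}"
proof -
  have "monomial_dvd (Poly_Mapping.single y 1) w \<longleftrightarrow> y \<in> keys w" for y and w :: "'a \<Rightarrow>\<^sub>0 nat"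
    by (auto simp: monomial_dvd_def lookup_single when_def in_keys_iff)
  then show ?thesis by (auto simp: multiples_def variables_def)
qed

text \<open>Modulo the ideal a polynomial equals its part free of \<open>Y\<close>, and products of
  such parts stay free of \<open>Y\<close>. A product in the ideal therefore forces the product of
  the two parts to be zero; the linear order on the variables makes the polynomial type free of zero
  divisors.\<close>

lemma primeideal_variables:
  fixes X Y :: "'x::linorder set"
  assumes Y: "Y \<subseteq> X"
  shows "primeideal (Idl\<^bsub>poly_ring X\<^esub> (mon ` variables Y)) (poly_ring X :: ('x, 'k::field) mpoly ring)"
proof (rule primeidealI)
  let ?P = "Idl\<^bsub>poly_ring X\<^esub> (mon ` variables Y) :: ('x, 'k) mpoly set"
  let ?A = "{w. keys w \<inter> Y = {}}"
  have mem: "p \<in> ?P \<longleftrightarrow> p \<in> carrier (poly_ring X) \<and> keys p \<inter> ?A = {}" for p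
    unfolding mem_monomial_ideal_iff[OF variables_subset[OF Y]] multiples_variables by blast
  show id: "ideal ?P (poly_ring X)" by (rule ideal_monomial_ideal[OF variables_subset[OF Y]])
  show "cring (poly_ring X :: ('x, 'k) mpoly ring)" by (rule cring_poly_ring)
  have "1 \<notin> ?P" unfolding mem by simp
  moreover have "1 \<in> carrier (poly_ring X :: ('x, 'k) mpoly ring)" by (simp add: carrier_poly_ring_iff)
  ultimately show "carrier (poly_ring X) \<noteq> ?P" by blast
  interpret R: cring "poly_ring X :: ('x, 'k) mpoly ring" by (rule cring_poly_ring)
  interpret P: ideal ?P "poly_ring X" by (rule id)
  fix p q :: "('x, 'k) mpoly"
  assume p: "p \<in> carrier (poly_ring X)" and q: "q \<in> carrier (poly_ring X)"
    and pq: "p \<otimes>\<^bsub>poly_ring X\<^esub> q \<in> ?P"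
  let ?r = "restrict_keys ?A"
  have rc: "?r a \<in> carrier (poly_ring X)" if "a \<in> carrier (poly_ring X)" for a :: "('x, 'k) mpoly"
    using that by (auto simp: carrier_poly_ring_iff keys_restrict_keys)
  have diff: "a - ?r a \<in> ?P" if "a \<in> carrier (poly_ring X)" for a
    unfolding mem using diff_poly_ring_closed[OF that rc[OF that]]
    by (auto simp: in_keys_iff lookup_minus lookup_restrict_keys)
  have "p * (q - ?r q) + (p - ?r p) * ?r q \<in> ?P"
    using P.a_closed[OF P.I_l_closed[OF diff[OF q] p] P.I_r_closed[OF diff[OF p] rc[OF q]]] by simp
  then have "p * q - ?r p * ?r q \<in> ?P" by (simp add: algebra_simps)
  then have d: "keys (p * q - ?r p * ?r q) \<inter> ?A = {}" unfolding mem by blast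
  have pq': "keys (p * q) \<inter> ?A = {}" using pq unfolding mem by simp
  have sub: "keys (?r p * ?r q) \<subseteq> ?A"
  proof
    fix w assume "w \<in> keys (?r p * ?r q)"
    then obtain u v where "u \<in> ?A" "v \<in> ?A" "w = u + v"
      using keys_mult[of "?r p" "?r q"] by (auto simp: keys_restrict_keys)
    then show "w \<in> ?A" using keys_add[of u v] by blast
  qed
  have "lookup (?r p * ?r q) w = 0" for w
  proof (cases "w \<in> ?A")
    case True
    then have "w \<notin> keys (p * q - ?r p * ?r q)" "w \<notin> keys (p * q)" using d pq' by blast+
    then show ?thesis by (simp add: in_keys_iff lookup_minus)
  next
    case False
    then have "w \<notin> keys (?r p * ?r q)" using sub by blast
    then show ?thesis by (simp add: in_keys_iff)
  qed
  then have "?r p * ?r q = 0" by (intro poly_mapping_eqI) simp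
  then have "?r p = 0 \<or> ?r q = 0" by simp
  then show "p \<in> ?P \<or> q \<in> ?P" using diff[OF p] diff[OF q] by auto
qed

text \<open>To the prime generated by the variables outside \<open>Z\<close>, the variables of
  \<open>Z\<close> are adjoined one at a time. All these primes contain \<open>J\<close> because
  every generator involves a variable outside \<open>Z\<close>, so their images form a chain with
  \<open>card Z\<close> strict steps.\<close>

lemma krull_dim_ge:
  fixes X :: "'x::linorder set" and J :: "('x, 'k::field) mpoly set"
  assumes X: "finite X" and M: "M \<subseteq> monomials X" and J: "J = Idl\<^bsub>poly_ring X\<^esub> (mon ` M)"
    and Z: "Z \<subseteq> X" and face: "\<And>m. m \<in> M \<Longrightarrow> \<not> keys m \<subseteq> Z"
  shows "enat (card Z) \<le> krull_dim (poly_ring X Quot J)"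
proof -
  interpret R: cring "poly_ring X :: ('x, 'k) mpoly ring" by (rule cring_poly_ring)
  have id: "ideal J (poly_ring X)" unfolding J by (rule ideal_monomial_ideal[OF M])
  obtain zs where zs: "set zs = Z" "distinct zs"
    using finite_distinct_list[of Z] X Z finite_subset by metis
  have len: "length zs = card Z" using zs distinct_card by metis
  define Y where "Y i = (X - Z) \<union> set (take i zs)" for i
  define Q where "Q i = (Idl\<^bsub>poly_ring X\<^esub> (mon ` variables (Y i)) :: ('x, 'k) mpoly set)" for i
  define P where "P i = (\<lambda>p. J +>\<^bsub>poly_ring X\<^esub> p) ` Q i" for i
  have YX: "Y i \<subseteq> X" for i
    unfolding Y_def using Z zs(1) set_take_subset[of i zs] by blast
  have mem: "p \<in> Q i \<longleftrightarrow> p \<in> carrier (poly_ring X) \<and> (\<forall>w\<in>keys p. keys w \<inter> Y i \<noteq> {})" for p i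
    unfolding Q_def mem_monomial_ideal_iff[OF variables_subset[OF YX]] multiples_variables by blast
  have JQ: "J \<subseteq> Q i" for i
  proof
    fix p assume p: "p \<in> J"
    have "keys w \<inter> Y i \<noteq> {}" if w: "w \<in> keys p" for w
    proof -
      obtain m where m: "m \<in> M" "monomial_dvd m w"
        using p w by (auto simp: J mem_monomial_ideal_iff[OF M] multiples_def)
      then obtain x where "x \<in> keys m" "x \<notin> Z" using face by blast
      moreover have "x \<in> X" using m(1) M \<open>x \<in> keys m\<close> by (auto simp: monomials_def)
      moreover have "x \<in> keys w"
        using m(2) \<open>x \<in> keys m\<close> by (auto simp: monomial_dvd_def in_keys_iff dest: spec[of _ x])
      ultimately show ?thesis by (auto simp: Y_def)
    qed
    then show "p \<in> Q i"
      unfolding mem using p by (auto simp: J mem_monomial_ideal_iff[OF M])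
  qed
  have prime: "primeideal (Q i) (poly_ring X)" for i
    unfolding Q_def by (rule primeideal_variables[OF YX])
  have Pprime: "primeideal (P i) (poly_ring X Quot J)" for i
    unfolding P_def by (rule R.primeideal_Quot[OF id prime JQ])
  have strict: "P i \<subset> P (Suc i)" if i: "i < card Z" for i
  proof -
    let ?z = "zs ! i"
    let ?v = "mon (Poly_Mapping.single ?z 1) :: ('x, 'k) mpoly"
    have Y: "Y (Suc i) = insert ?z (Y i)"
      using i by (auto simp: Y_def len take_Suc_conv_app_nth)
    have "?z \<in> Z" using i zs(1) len by (metis nth_mem)
    moreover have "?z \<notin> set (take i zs)"
      using i zs(2) len by (auto simp: in_set_conv_nth nth_eq_iff_index_eq)
    ultimately have z: "?z \<notin> Y i" "?z \<in> X" using Z by (auto simp: Y_def)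
    have vc: "?v \<in> carrier (poly_ring X)" using z(2) by (simp add: monomials_def)
    have "Q i \<subseteq> Q (Suc i)"
    proof
      fix p assume "p \<in> Q i"
      then show "p \<in> Q (Suc i)" unfolding mem Y by blast
    qed
    then have "P i \<subseteq> P (Suc i)" unfolding P_def by blast
    moreover have "?v \<in> Q (Suc i)" "?v \<notin> Q i" using z vc unfolding mem Y by simp_all
    ultimately show ?thesis
      unfolding P_def
      using R.Quot_image_mem_iff[OF id primeideal.axioms(1)[OF prime] JQ vc, of i] by blast
  qed
  show ?thesis
    unfolding krull_dim_def using Pprime strict by (intro Sup_upper) blast
qed

section \<open>Polarization of monomials\<close>

text \<open>The exponent vector of \<open>u^p\<close>. No bound \<open>i \<le> n\<close> is imposed;
  agreement with \<open>polar_mon n u\<close> is shown for \<open>u\<close> in the variables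
  \<open>{1..n}\<close>.\<close>

lift_definition polar_exp :: "(nat \<Rightarrow>\<^sub>0 nat) \<Rightarrow> nat \<times> nat \<Rightarrow>\<^sub>0 nat" is
  "\<lambda>u (i, j). if 1 \<le> j \<and> j \<le> u i then 1 else 0"
proof -
  fix u :: "nat \<Rightarrow> nat"
  assume "finite {i. u i \<noteq> 0}"
  then have "finite (SIGMA i:{i. u i \<noteq> 0}. {1..u i})" by auto
  then show "finite {x. (case x of (i, j) \<Rightarrow> if 1 \<le> j \<and> j \<le> u i then 1 else (0 :: nat)) \<noteq> 0}"
    by (rule rev_finite_subset) (auto split: if_splits)
qed

lemma lookup_polar_exp:
  "lookup (polar_exp u) (i, j) = (if 1 \<le> j \<and> j \<le> lookup u i then 1 else 0)"
  by transfer simp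

lemma keys_polar_exp: "(i, j) \<in> keys (polar_exp u) \<longleftrightarrow> 1 \<le> j \<and> j \<le> lookup u i"
  by (simp add: in_keys_iff lookup_polar_exp)

lemma prod_mon: "finite A \<Longrightarrow> (\<Prod>i\<in>A. mon (f i)) = (mon (\<Sum>i\<in>A. f i) :: ('x, 'k::field) mpoly)"
  by (induction A rule: finite_induct) (simp_all add: mon_mult, simp add: mon_def)

lemma polar_mon_eq:
  assumes u: "u \<in> monomials {1..n}"
  shows "polar_mon n u = (mon (polar_exp u) :: (nat \<times> nat, 'k::field) mpoly)"
proof -
  let ?s = "\<Sum>i=1..n. \<Sum>j=1..lookup u i. Poly_Mapping.single (i, j) (1::nat)"
  have "lookup ?s (a, b) = lookup (polar_exp u) (a, b)" for a b
  proof -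
    have "lookup ?s (a, b) = (\<Sum>i=1..n. if i = a then (\<Sum>j=1..lookup u a. if j = b then 1 else 0) else 0)"
      unfolding lookup_sum by (intro sum.cong refl) (auto simp: lookup_single when_def intro!: sum.cong)
    also have "\<dots> = (if a \<in> {1..n} \<and> b \<in> {1..lookup u a} then 1 else 0)" by simp
    also have "\<dots> = lookup (polar_exp u) (a, b)"
    proof (cases "a \<in> {1..n}")
      case False
      then have "lookup u a = 0" using u by (auto simp: monomials_def in_keys_iff subset_iff)
      then show ?thesis using False by (auto simp: lookup_polar_exp)
    qed (simp add: lookup_polar_exp)
    finally show ?thesis .
  qed
  then have "lookup ?s x = lookup (polar_exp u) x" for x
    by (cases x) (simp only:)
  then have "?s = polar_exp u" by (rule poly_mapping_eqI)
  then show ?thesis by (simp add: polar_mon_def Var_def prod_mon)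
qed

section \<open>Initial runs of variables dividing a monomial\<close>

definition segment :: "(nat \<times> nat \<Rightarrow>\<^sub>0 nat) \<Rightarrow> nat \<Rightarrow> nat" where
  "segment v i = (LEAST b. (i, Suc b) \<notin> keys v)"

lemma Suc_segment_notin: "(i, Suc (segment v i)) \<notin> keys v"
proof -
  have "inj (\<lambda>b. (i, Suc b))" by (simp add: inj_def)
  then have "\<exists>b. (i, Suc b) \<notin> keys v"
    using finite_keys[of v] by (metis finite_imageD finite_subset image_subsetI infinite_UNIV_nat)
  then show ?thesis unfolding segment_def by (rule LeastI_ex)
qed

lemma le_segment_iff: "b \<le> segment v i \<longleftrightarrow> (\<forall>j. 1 \<le> j \<and> j \<le> b \<longrightarrow> (i, j) \<in> keys v)"
proof
  assume b: "b \<le> segment v i"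
  show "\<forall>j. 1 \<le> j \<and> j \<le> b \<longrightarrow> (i, j) \<in> keys v"
  proof (intro allI impI)
    fix j assume j: "1 \<le> j \<and> j \<le> b"
    then have "j - 1 < segment v i" using b by linarith
    then have "(i, Suc (j - 1)) \<in> keys v" unfolding segment_def using not_less_Least by blast
    then show "(i, j) \<in> keys v" using j by simp
  qed
next
  assume R: "\<forall>j. 1 \<le> j \<and> j \<le> b \<longrightarrow> (i, j) \<in> keys v"
  show "b \<le> segment v i"
  proof (rule ccontr)
    assume "\<not> b \<le> segment v i"
    then show False using R Suc_segment_notin[of i v] by auto
  qed
qed

lemma segment_eq_iff: "b \<le> segment v i \<Longrightarrow> segment v i = b \<longleftrightarrow> (i, Suc b) \<notin> keys v"
proof
  assume b: "b \<le> segment v i" and notin: "(i, Suc b) \<notin> keys v"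
  then have "\<not> Suc b \<le> segment v i"
    unfolding le_segment_iff by auto
  then show "segment v i = b" using b by simp
qed (auto simp: Suc_segment_notin)

definition depolarize :: "(nat \<times> nat \<Rightarrow>\<^sub>0 nat) \<Rightarrow> nat \<Rightarrow>\<^sub>0 nat" where
  "depolarize v = Abs_poly_mapping (segment v)"

text \<open>A positive entry at \<open>i\<close> puts \<open>(i, 1)\<close> into the support of
  \<open>v\<close>, so \<open>segment v\<close> has finite support and
  \<open>Abs_poly_mapping\<close> applies to it.\<close>

lemma lookup_depolarize [simp]: "lookup (depolarize v) = segment v"
proof -
  have "i \<in> fst ` keys v" if "segment v i \<noteq> 0" for i
  proof -
    have "1 \<le> segment v i" using that by simp
    then have "(i, 1) \<in> keys v" unfolding le_segment_iff by blast
    then show ?thesis by force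
  qed
  then have "{i. segment v i \<noteq> 0} \<subseteq> fst ` keys v" by blast
  then have "finite {i. segment v i \<noteq> 0}"
    using finite_keys by (rule finite_subset[OF _ finite_imageI])
  then show ?thesis by (simp add: depolarize_def)
qed

text \<open>\<open>polar_exp u\<close> is squarefree, with a run of length \<open>lookup u i\<close>
  in row \<open>i\<close>; dividing \<open>v\<close> means that each row of \<open>v\<close> has a
  run at least that long. Polarization and \<open>depolarize\<close> thus form a Galois connection
  for divisibility.\<close>

lemma monomial_dvd_polar_exp: "monomial_dvd (polar_exp u) v \<longleftrightarrow> monomial_dvd u (depolarize v)"
proof -
  have "monomial_dvd (polar_exp u) v \<longleftrightarrow> (\<forall>i j. 1 \<le> j \<and> j \<le> lookup u i \<longrightarrow> (i, j) \<in> keys v)"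
    unfolding monomial_dvd_def split_paired_All lookup_polar_exp
    by (simp add: in_keys_iff Suc_le_eq)
  then show ?thesis by (simp add: monomial_dvd_def le_segment_iff)
qed

lemma mem_multiples_polar_exp: "v \<in> multiples (polar_exp ` G) \<longleftrightarrow> depolarize v \<in> multiples G"
  by (simp add: multiples_def monomial_dvd_polar_exp)

lemma finite_polar_vars [simp]: "finite (polar_vars n G)"
proof -
  have "polar_vars n G = (SIGMA i:{1..n}. {1..max_exponent G i})"
    by (auto simp: polar_vars_def)
  then show ?thesis by simp
qed

lemma segment_le:
  assumes v: "v \<in> monomials (polar_vars n G)"
  shows "segment v i \<le> max_exponent G i" and "i \<notin> {1..n} \<Longrightarrow> segment v i = 0"
proof -
  have "(i, segment v i) \<in> polar_vars n G" if "segment v i \<noteq> 0"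
    using le_segment_iff[of "segment v i" v i] v that by (auto simp: monomials_def)
  then show "segment v i \<le> max_exponent G i" "i \<notin> {1..n} \<Longrightarrow> segment v i = 0"
    by (cases "segment v i = 0"; auto simp: polar_vars_def)+
qed

lemma lookup_le_max_exponent:
  "finite G \<Longrightarrow> u \<in> G \<Longrightarrow> lookup u i \<le> max_exponent G i"
  unfolding max_exponent_def by (rule Max_ge) auto

lemma polar_exp_closed:
  assumes "u \<in> monomials {1..n}" "\<And>i. lookup u i \<le> max_exponent G i"
  shows "polar_exp u \<in> monomials (polar_vars n G)"
proof -
  have "(i, j) \<in> polar_vars n G" if "(i, j) \<in> keys (polar_exp u)" for i j
  proof -
    have j: "1 \<le> j" "j \<le> lookup u i" using that by (simp_all add: keys_polar_exp)
    then have "i \<in> keys u" by (simp add: in_keys_iff)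
    then have "i \<in> {1..n}" using assms(1) by (auto simp: monomials_def)
    then show ?thesis using j assms(2)[of i] by (simp add: polar_vars_def)
  qed
  then show ?thesis by (auto simp: monomials_def)
qed

section \<open>Preimages of cones under \<open>depolarize\<close>\<close>

definition polar_cone_vars :: "nat \<Rightarrow> (nat \<Rightarrow>\<^sub>0 nat) set \<Rightarrow> (nat \<Rightarrow>\<^sub>0 nat) \<Rightarrow> nat set \<Rightarrow> (nat \<times> nat) set" where
  "polar_cone_vars n G u Z = polar_vars n G - {(i, Suc (lookup u i)) | i. i \<notin> Z}"

text \<open>If \<open>u^p\<close> divides \<open>v\<close>, the run in row \<open>i\<close> has
  length exactly \<open>lookup u i\<close> iff the next variable does not divide \<open>v\<close>.
  For \<open>i \<notin> Z\<close> this next variable is the one removed; all other variables,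
  including those dividing \<open>u^p\<close>, may carry arbitrary further exponents.\<close>

lemma mem_polar_cone_iff:
  assumes u: "u \<in> monomials {1..n}" "\<And>i. lookup u i \<le> max_exponent G i"
    and v: "v \<in> monomials (polar_vars n G)"
  shows "v \<in> cone (polar_exp u) (polar_cone_vars n G u Z) \<longleftrightarrow> depolarize v \<in> cone u Z"
proof -
  have out: "lookup v x = 0 \<and> lookup (polar_exp u) x = 0" if "x \<notin> polar_vars n G" for x
  proof -
    have "x \<notin> keys v" "x \<notin> keys (polar_exp u)"
      using that v polar_exp_closed[OF u] by (auto simp: monomials_def)
    then show ?thesis by (simp add: in_keys_iff)
  qed
  have "(\<forall>x. x \<notin> polar_cone_vars n G u Z \<longrightarrow> lookup v x = lookup (polar_exp u) x)
      \<longleftrightarrow> (\<forall>i. i \<notin> Z \<longrightarrow> (i, Suc (lookup u i)) \<notin> keys v)"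
    (is "?L \<longleftrightarrow> ?R")
  proof
    assume L: ?L
    show ?R
    proof (intro allI impI)
      fix i assume "i \<notin> Z"
      then have "(i, Suc (lookup u i)) \<notin> polar_cone_vars n G u Z"
        by (auto simp: polar_cone_vars_def)
      then show "(i, Suc (lookup u i)) \<notin> keys v"
        using L by (simp add: in_keys_iff lookup_polar_exp)
    qed
  next
    assume R: ?R
    show ?L
    proof (intro allI impI)
      fix x assume "x \<notin> polar_cone_vars n G u Z"
      then consider "x \<notin> polar_vars n G" | i where "x = (i, Suc (lookup u i))" "i \<notin> Z"
        by (auto simp: polar_cone_vars_def)
      then show "lookup v x = lookup (polar_exp u) x"
      proof cases
        case 1
        then show ?thesis using out[of x] by simp
      next
        case 2
        then show ?thesis using R by (simp add: in_keys_iff lookup_polar_exp)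
      qed
    qed
  qed
  moreover have "(\<forall>x. lookup (polar_exp u) x \<le> lookup v x) \<longleftrightarrow> (\<forall>i. lookup u i \<le> segment v i)"
    using monomial_dvd_polar_exp[of u v] by (simp add: monomial_dvd_def)
  ultimately show ?thesis
    unfolding mem_cone_iff lookup_depolarize using segment_eq_iff by blast
qed

text \<open>At most one variable is removed for each of the \<open>n - card Z\<close> indices
  outside \<open>Z\<close>. The additive form avoids truncated subtraction.\<close>

lemma card_polar_cone_vars:
  assumes Z: "Z \<subseteq> {1..n}"
  shows "card (polar_vars n G) + card Z \<le> card (polar_cone_vars n G u Z) + n"
proof -
  let ?W = "polar_cone_vars n G u Z"
  have "polar_vars n G - ?W \<subseteq> (\<lambda>i. (i, Suc (lookup u i))) ` ({1..n} - Z)"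
    by (auto simp: polar_cone_vars_def polar_vars_def)
  then have "card (polar_vars n G - ?W) \<le> card ({1..n} - Z)"
    by (rule surj_card_le[rotated]) simp
  also have "\<dots> = n - card Z" using Z by (simp add: card_Diff_subset finite_subset)
  finally have "card (polar_vars n G - ?W) \<le> n - card Z" .
  moreover have "card (polar_vars n G - ?W) = card (polar_vars n G) - card ?W"
    by (intro card_Diff_subset) (auto simp: polar_cone_vars_def intro: finite_subset)
  moreover have "card Z \<le> n" using card_mono[OF _ Z] by simp
  ultimately show ?thesis by linarith
qed

text \<open>Each retained cone is the preimage of a cone of \<open>D\<close> under
  \<open>depolarize\<close>, so the partition pulls back. The dropped cones have empty preimage,
  since the exponents of \<open>depolarize v\<close> never exceed those of
  \<open>max_exponent G\<close>.\<close>

lemma cone_partition_polarization: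
  assumes D: "cone_partition (monomials {1..n} - multiples G) D"
    and DX: "\<And>u Z. (u, Z) \<in> D \<Longrightarrow> u \<in> monomials {1..n} \<and> Z \<subseteq> {1..n}"
  shows "cone_partition (monomials (polar_vars n G) - multiples (polar_exp ` G))
    ((\<lambda>(u, Z). (polar_exp u, polar_cone_vars n G u Z)) `
      {(u, Z) \<in> D. \<forall>i. lookup u i \<le> max_exponent G i})"
    (is "cone_partition ?B (?h ` ?D)")
proof -
  have fin: "finite D" and sub: "\<And>u Z. (u, Z) \<in> D \<Longrightarrow> cone u Z \<subseteq> monomials {1..n} - multiples G"
    and part: "\<And>w. w \<in> monomials {1..n} - multiples G \<Longrightarrow> \<exists>!d. d \<in> D \<and> w \<in> cone (fst d) (snd d)"
    using D by (auto simp: cone_partition_def)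
  have mem: "v \<in> cone (polar_exp u) (polar_cone_vars n G u Z) \<longleftrightarrow> depolarize v \<in> cone u Z"
    if "v \<in> monomials (polar_vars n G)" "(u, Z) \<in> ?D" for v u Z
    using that DX by (intro mem_polar_cone_iff) auto
  have fin': "finite (?h ` ?D)"
    using fin by (intro finite_imageI finite_subset[of ?D D]) auto
  have "cone (polar_exp u) (polar_cone_vars n G u Z) \<subseteq> ?B" if uZ: "(u, Z) \<in> ?D" for u Z
  proof
    fix v assume v: "v \<in> cone (polar_exp u) (polar_cone_vars n G u Z)"
    have "cone (polar_exp u) (polar_cone_vars n G u Z) \<subseteq> monomials (polar_vars n G)"
      using uZ DX by (intro cone_subset_monomials polar_exp_closed) (auto simp: polar_cone_vars_def)
    then have vm: "v \<in> monomials (polar_vars n G)" using v by blast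
    then have "depolarize v \<in> cone u Z" using mem[OF vm uZ] v by simp
    then show "v \<in> ?B" using vm sub[of u Z] uZ by (auto simp: mem_multiples_polar_exp)
  qed
  then have sub': "\<forall>(u, Z)\<in>?h ` ?D. cone u Z \<subseteq> ?B"
    by (intro ballI) (auto simp only: case_prod_conv image_iff)
  have part': "\<exists>!d. d \<in> ?h ` ?D \<and> v \<in> cone (fst d) (snd d)" if v: "v \<in> ?B" for v
  proof -
    have vm: "v \<in> monomials (polar_vars n G)" using v by blast
    have "depolarize v \<in> monomials {1..n}"
      unfolding monomials_def using segment_le(2)[OF vm] by (force simp: in_keys_iff)
    then have dv: "depolarize v \<in> monomials {1..n} - multiples G"
      using v by (simp add: mem_multiples_polar_exp)
    then obtain u Z where uZ: "(u, Z) \<in> D" "depolarize v \<in> cone u Z"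
      using part by (metis prod.collapse)
    have "(u, Z) \<in> ?D"
      using uZ segment_le(1)[OF vm] by (auto simp: mem_cone_iff intro: order_trans)
    then have "?h (u, Z) \<in> ?h ` ?D \<and> v \<in> cone (fst (?h (u, Z))) (snd (?h (u, Z)))"
      using mem[OF vm] uZ(2) by (intro conjI imageI) auto
    moreover have "e = ?h (u, Z)" if e: "e \<in> ?h ` ?D \<and> v \<in> cone (fst e) (snd e)" for e
    proof -
      obtain u' Z' where e': "(u', Z') \<in> ?D" "e = ?h (u', Z')" using e by auto
      then have "depolarize v \<in> cone u' Z'" using e mem[OF vm e'(1)] by simp
      moreover have "(u', Z') \<in> D" using e'(1) by simp
      ultimately have "(u', Z') = (u, Z)"
        using part[OF dv] uZ by (metis fst_conv snd_conv)
      then show ?thesis using e'(2) by simp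
    qed
    ultimately show ?thesis by (rule ex1I)
  qed
  show ?thesis
    unfolding cone_partition_def by (intro conjI fin' sub' ballI part')
qed

section \<open>Faces of the polarized ideal compared with faces of the original\<close>

lift_definition indicator_exp :: "'a set \<Rightarrow> 'a \<Rightarrow>\<^sub>0 nat" is
  "\<lambda>F x. if finite F \<and> x \<in> F then 1 else 0"
  by auto

lemma keys_indicator_exp: "finite F \<Longrightarrow> keys (indicator_exp F) = F"
  by transfer auto

text \<open>A generator supported on the rows that lie entirely in \<open>F\<close> would have its
  polarization supported on \<open>F\<close>. Every other row has a first gap, so \<open>F\<close>
  misses at least \<open>n - card Z\<close> variables.\<close>

lemma polar_face:
  assumes G: "finite G" "G \<subseteq> monomials {1..n}" and F: "F \<subseteq> polar_vars n G"
    and face: "\<And>g. g \<in> G \<Longrightarrow> \<not> keys (polar_exp g) \<subseteq> F"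
  obtains Z where "Z \<subseteq> {1..n}" "\<And>g. g \<in> G \<Longrightarrow> \<not> keys g \<subseteq> Z"
    "card F + n \<le> card (polar_vars n G) + card Z"
proof
  define v where "v = indicator_exp F"
  have "finite F" using F finite_polar_vars by (rule finite_subset)
  then have kv: "keys v = F" by (simp add: v_def keys_indicator_exp)
  then have vm: "v \<in> monomials (polar_vars n G)" using F by (simp add: monomials_def)
  \<comment> \<open>The rows lying entirely in \<open>F\<close>; rows with
    \<open>max_exponent G i = 0\<close> qualify trivially.\<close>
  define Z where "Z = {i \<in> {1..n}. segment v i = max_exponent G i}"
  show Z: "Z \<subseteq> {1..n}" by (auto simp: Z_def)
  show "\<not> keys g \<subseteq> Z" if g: "g \<in> G" for g
  proof
    assume gZ: "keys g \<subseteq> Z"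
    have "lookup g i \<le> segment v i" for i
    proof (cases "i \<in> keys g")
      case True
      then show ?thesis using gZ lookup_le_max_exponent[OF G(1) g, of i] by (auto simp: Z_def)
    qed (simp add: in_keys_iff)
    then have "keys (polar_exp g) \<subseteq> F"
      using le_segment_iff[of _ v] by (auto simp: kv keys_polar_exp)
    then show False using face[OF g] by blast
  qed
  let ?s = "\<lambda>i. (i, Suc (segment v i))"
  have inj: "inj_on ?s ({1..n} - Z)" by (simp add: inj_on_def)
  have "?s i \<in> polar_vars n G - F" if i: "i \<in> {1..n} - Z" for i
    using i segment_le(1)[OF vm, of i] Suc_segment_notin[of i v]
    by (auto simp: Z_def polar_vars_def kv)
  then have "card ({1..n} - Z) \<le> card (polar_vars n G - F)"
    by (intro card_inj_on_le[OF inj]) auto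
  moreover have "card ({1..n} - Z) = n - card Z" using Z by (simp add: card_Diff_subset finite_subset)
  moreover have "card (polar_vars n G - F) = card (polar_vars n G) - card F"
    using F \<open>finite F\<close> by (simp add: card_Diff_subset)
  moreover have "card F \<le> card (polar_vars n G)" using F by (intro card_mono) auto
  ultimately show "card F + n \<le> card (polar_vars n G) + card Z" by linarith
qed

section \<open>Transfer of the decomposition and of the depth bound to the polarization\<close>

theorem theorem2p5:
  fixes n :: nat
    and I :: "(nat, 'k::field) mpoly set"
    and G :: "(nat \<Rightarrow>\<^sub>0 nat) set"
  assumes "monomial_ideal {1..n} I"
    and "minimally_generated {1..n} I G"
    and "cohen_macaulay_quot {1..n} I"
    and "stanley_ideal {1..n} I"
  shows "stanley_ideal (polar_vars n G) (polarization n G :: (nat \<times> nat, 'k) mpoly set)"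
proof -
  let ?X = "polar_vars n G"
  let ?M = "polar_exp ` G"
  let ?J = "polarization n G :: (nat \<times> nat, 'k) mpoly set"
  have G: "finite G" "G \<subseteq> monomials {1..n}" and I: "I = Idl\<^bsub>poly_ring {1..n}\<^esub> (mon ` G)"
    using assms(2) by (auto simp: minimally_generated_def)
  obtain D where D: "stanley_decomposition {1..n} I D"
    "\<forall>(u, Z)\<in>D. depth_quot {1..n} I \<le> enat (card Z)"
    using assms(4) by (auto simp: stanley_ideal_def)
  have DX: "u \<in> monomials {1..n} \<and> Z \<subseteq> {1..n}" if "(u, Z) \<in> D" for u Z
    using D(1) that by (auto simp: stanley_decomposition_def is_stanley_space_def)
  have MX: "?M \<subseteq> monomials ?X"
    using G lookup_le_max_exponent[OF G(1)] by (auto intro!: polar_exp_closed)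
  have "polar_mon n ` G = (mon ` ?M :: (nat \<times> nat, 'k) mpoly set)"
    using G(2) by (force simp: image_image polar_mon_eq subset_iff)
  then have J: "?J = Idl\<^bsub>poly_ring ?X\<^esub> (mon ` ?M)"
    by (simp add: polarization_def)
  define D' where "D' = (\<lambda>(u, Z). (polar_exp u, polar_cone_vars n G u Z)) `
    {(u, Z) \<in> D. \<forall>i. lookup u i \<le> max_exponent G i}"
  have "cone_partition (monomials ?X - multiples ?M) D'"
    unfolding D'_def
    by (rule cone_partition_polarization[OF cone_partition_of_stanley_decomposition[OF G(2) I D(1)] DX])
  moreover have "w \<in> monomials ?X \<and> W \<subseteq> ?X" if "(w, W) \<in> D'" for w W
    using that DX by (auto simp: D'_def polar_cone_vars_def intro!: polar_exp_closed)
  ultimately have dec: "stanley_decomposition ?X ?J D'"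
    by (rule stanley_decomposition_of_cone_partition[OF MX J])
  \<comment> \<open>If \<open>1\<close> lay in the polarization, it would lie in \<open>I\<close>
    because \<open>depolarize\<close> sends \<open>0\<close> to \<open>0\<close>; the
    Cohen--Macaulay hypothesis makes \<open>I\<close> proper.\<close>
  have proper: "?J \<noteq> carrier (poly_ring ?X)"
  proof
    assume "?J = carrier (poly_ring ?X)"
    then have "mon 0 \<in> ?J" by (simp add: monomials_def)
    then have "0 \<in> multiples ?M" by (simp add: J mem_monomial_ideal_iff[OF MX])
    moreover have "depolarize 0 = 0"
      by (rule poly_mapping_eqI) (simp add: segment_def)
    ultimately have "0 \<in> multiples G" by (simp add: mem_multiples_polar_exp)
    then have "keys p \<subseteq> multiples G" for p :: "(nat, 'k) mpoly"
      using add_mem_multiples[of 0 G] by auto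
    then have "I = carrier (poly_ring {1..n})"
      unfolding I using mem_monomial_ideal_iff[OF G(2)] by blast
    then show False using assms(3) by (simp add: cohen_macaulay_quot_def)
  qed
  have squarefree: "lookup m x \<le> 1" if "m \<in> ?M" for m x
    using that by (cases x) (auto simp: lookup_polar_exp)
  have "depth_quot ?X ?J \<le> enat (card W)" if wW: "(w, W) \<in> D'" for w W
  proof -
    obtain u Z where uZ: "(u, Z) \<in> D" and W: "W = polar_cone_vars n G u Z"
      using wW by (auto simp: D'_def)
    \<comment> \<open>\<open>card F\<close> exceeds \<open>card Z'\<close> by at most, and
      \<open>card W\<close> exceeds \<open>card Z\<close> by at least, the integer
      \<open>card ?X - n\<close>; so \<open>card Z' \<le> card Z\<close> suffices.\<close>
    have faces: "card F \<le> card W" if F: "F \<subseteq> ?X" "\<And>m. m \<in> ?M \<Longrightarrow> \<not> keys m \<subseteq> F" for F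
    proof -
      obtain Z' where Z': "Z' \<subseteq> {1..n}" "\<And>g. g \<in> G \<Longrightarrow> \<not> keys g \<subseteq> Z'"
        "card F + n \<le> card ?X + card Z'"
        using polar_face[OF G F(1)] F(2) by blast
      have "enat (card Z') \<le> krull_dim (poly_ring {1..n} Quot I)"
        by (rule krull_dim_ge[OF _ G(2) I Z'(1,2)]) simp
      \<comment> \<open>Cohen--Macaulayness leads from dimension, which bounds faces, to depth,
        which the Stanley property bounds by \<open>card Z\<close>.\<close>
      also have "\<dots> = depth_quot {1..n} I"
        using assms(3) by (simp add: cohen_macaulay_quot_def)
      also have "\<dots> \<le> enat (card Z)" using D(2) uZ by auto
      finally have "card Z' \<le> card Z" by simp
      then show ?thesis
        using Z'(3) card_polar_cone_vars[of Z n G u] DX[OF uZ] by (simp add: W)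
    qed
    show ?thesis
      by (intro depth_quot_le[OF finite_polar_vars MX J] squarefree faces proper)
  qed
  then show ?thesis
    unfolding stanley_ideal_def using dec by (intro exI[of _ D']) auto
qed

end
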